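(* Let $\tau\in(2,3)$, $\mu=(\tau-1)/(\tau-2)$ and $\gamma_n=\sqrt{n\mu}$. Let $f:[0,\infty)\to[0,\infty)$ be continuous and nondecreasing with $f(x)/x\to1$ as $x\downarrow0$ and $f(x)\to1$ as $x\to\infty$. Consider the rank-1 inhomogeneous random graph on $n$ vertices with i.i.d. weights having density $\rho(h)=(\tau-1)h^{-\tau}$, $h\ge1$, and connection probability $p(h,h')=f(hh'/\gamma_n^2)$. For every fixed odd integer $k\ge3$, the average number $C_k(n)$ of cycles of size $k$ satisfies, as $n\to\infty$, $$C_k(n)\sim\gamma_n^{k(1-\tau)}(\tau-1)^k\,\frac1{4k}\binom nk\,k!\left(\int_0^\infty x^{-\frac12(\tau+1)}f(x)\,dx\right)^k .$$
   Context: Model: the graph has $n$ vertices with i.i.d. weights $H_1,\dots,H_n$ with density $\rho$; conditionally on the weights, each pair of vertices $i\ne j$ is connected by an edge independently with probability $p(H_i,H_j)$. The average number of $k$-cycles is $$C_k(n)=\frac1{2k}\binom nk\,k!\int_1^\infty\cdots\int_1^\infty\rho(h_1)\cdots\rho(h_k)\,f\Big(\frac{h_1h_2}{\gamma_n^2}\Big)f\Big(\frac{h_2h_3}{\gamma_n^2}\Big)\cdots f\Big(\frac{h_{k-1}h_k}{\gamma_n^2}\Big)f\Big(\frac{h_kh_1}{\gamma_n^2}\Big)\,dh_1\cdots dh_k .$$ Notation: $g_1(n)\sim g_2(n)$ means $g_1(n)/g_2(n)\to1$ as $n\to\infty$. *)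

theory Defs
  imports "HOL-Probability.Probability"
begin

text \<open>The law of a single weight. It lives on \<open>{1..}\<close> rather than on the whole line, so that the
  function \<open>f\<close> below, about which nothing is known at negative arguments, is only ever
  evaluated on \<open>{0..}\<close>.\<close>

definition weight_law :: "real \<Rightarrow> real measure" where
  "weight_law \<tau> = density (restrict_space lborel {1..}) (\<lambda>h. ennreal ((\<tau> - 1) * h powr (- \<tau>)))"

definition weights_law :: "real \<Rightarrow> nat \<Rightarrow> (nat \<Rightarrow> real) measure" where
  "weights_law \<tau> n = PiM {1..n} (\<lambda>_. weight_law \<tau>)"

definition vertex_pairs :: "nat \<Rightarrow> (nat \<times> nat) set" where
  "vertex_pairs n = {(i, j). 1 \<le> i \<and> i < j \<and> j \<le> n}"

text \<open>A graph on \<open>{1..n}\<close> is represented by its set of edges \<open>{i, j}\<close>. The next definition is its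
  conditional law given the weights \<open>h\<close>.\<close>

definition graph_given_weights ::
    "(real \<Rightarrow> real \<Rightarrow> real) \<Rightarrow> nat \<Rightarrow> (nat \<Rightarrow> real) \<Rightarrow> nat set set pmf" where
  "graph_given_weights p n h =
     map_pmf (\<lambda>X. {{i, j} | i j. (i, j) \<in> vertex_pairs n \<and> X (i, j)})
       (Pi_pmf (vertex_pairs n) False (\<lambda>(i, j). bernoulli_pmf (p (h i) (h j))))"

definition inhom_random_graph ::
    "real \<Rightarrow> (real \<Rightarrow> real \<Rightarrow> real) \<Rightarrow> nat \<Rightarrow> nat set set measure" where
  "inhom_random_graph \<tau> p n =
     weights_law \<tau> n \<bind> (\<lambda>h. measure_pmf (graph_given_weights p n h))"

text \<open>Cycles are unrooted and unoriented, i.e. identified with their edge sets (\<open>k \<ge> 3\<close> is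
  intended).\<close>

definition is_cycle :: "nat \<Rightarrow> nat set set \<Rightarrow> bool" where
  "is_cycle k C \<longleftrightarrow>
     (\<exists>v. inj_on v {..<k} \<and> C = {{v i, v (Suc i mod k)} | i. i < k})"

definition num_cycles :: "nat \<Rightarrow> nat set set \<Rightarrow> nat" where
  "num_cycles k E = card {C. C \<subseteq> E \<and> is_cycle k C}"

definition mu :: "real \<Rightarrow> real" where
  "mu \<tau> = (\<tau> - 1) / (\<tau> - 2)"

definition gam :: "real \<Rightarrow> nat \<Rightarrow> real" where
  "gam \<tau> n = sqrt (real n * mu \<tau>)"

definition conn_prob :: "real \<Rightarrow> (real \<Rightarrow> real) \<Rightarrow> nat \<Rightarrow> real \<Rightarrow> real \<Rightarrow> real" where
  "conn_prob \<tau> f n h h' = f (h * h' / (gam \<tau> n)\<^sup>2)"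

definition avg_cycles :: "real \<Rightarrow> (real \<Rightarrow> real) \<Rightarrow> nat \<Rightarrow> nat \<Rightarrow> real" where
  "avg_cycles \<tau> f k n =
     (\<integral>G. real (num_cycles k G) \<partial>inhom_random_graph \<tau> (conn_prob \<tau> f n) n)"

text \<open>The kernel in \<open>inhom_random_graph\<close> is measurable and the random graph is a genuine
  probability space.\<close>

lemma prob_space_weight_law:
  assumes "1 < \<tau>"
  shows "prob_space (weight_law \<tau>)"
proof
  have "emeasure (weight_law \<tau>) (space (weight_law \<tau>)) =
      (\<integral>\<^sup>+h. ennreal ((\<tau> - 1) * h powr (- \<tau>)) \<partial>restrict_space lborel {1..})"
    unfolding weight_law_def space_density
    by (subst emeasure_density)
       (auto simp: nn_integral_indicator simp del: space_restrict_space2 intro!: measurable_restrict_space1 nn_integral_cong)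
  also have "\<dots> = (\<integral>\<^sup>+h. ennreal ((\<tau> - 1) * h powr (- \<tau>)) * indicator {1..} h \<partial>lborel)"
    by (rule nn_integral_restrict_space) auto
  also have "\<dots> = ennreal (0 - (- (1 powr (1 - \<tau>))))"
  proof (rule nn_integral_FTC_atLeast[where F = "\<lambda>x. - (x powr (1 - \<tau>))" and T = 0])
    fix x :: real assume "1 \<le> x"
    then show "((\<lambda>x. - (x powr (1 - \<tau>))) has_real_derivative (\<tau> - 1) * x powr (- \<tau>)) (at x)"
      by (auto intro!: derivative_eq_intros simp: algebra_simps)
  next
    show "((\<lambda>x. - (x powr (1 - \<tau>))) \<longlongrightarrow> 0) at_top"
      using tendsto_minus[OF tendsto_neg_powr[of "1-\<tau>" "\<lambda>x. x" at_top]] assms by (simp add: filterlim_ident)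
  qed (use assms in auto)
  finally show "emeasure (weight_law \<tau>) (space (weight_law \<tau>)) = 1" by simp
qed

lemma space_weight_law: "space (weight_law \<tau>) = {1..}"
  by (simp add: weight_law_def space_restrict_space)

lemma measurable_graph_given_weights:
  assumes m: "\<And>i j. (i,j) \<in> vertex_pairs n \<Longrightarrow> (\<lambda>h. p (h i) (h j)) \<in> borel_measurable (weights_law \<tau> n)"
  shows "(\<lambda>h. measure_pmf (graph_given_weights p n h))
    \<in> weights_law \<tau> n \<rightarrow>\<^sub>M subprob_algebra (count_space UNIV)"
proof (rule measurable_subprob_algebra)
  fix A :: "nat set set set"
  let ?V = "vertex_pairs n"
  let ?g = "\<lambda>X. {{i, j} | i j. (i, j) \<in> ?V \<and> X (i, j)}"
  have fV: "finite ?V"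
    by (rule finite_subset[of _ "{1..n} \<times> {1..n}"]) (auto simp: vertex_pairs_def)
  let ?D = "PiE_dflt ?V False (\<lambda>_. UNIV :: bool set)"
  have fD: "finite ?D" by (rule finite_PiE_dflt) (use fV in auto)
  have pm: "pmf (bernoulli_pmf q) b = (if b then min 1 (max 0 q) else 1 - min 1 (max 0 q))" for q b
    by (simp add: bernoulli_pmf.rep_eq)
  have "emeasure (measure_pmf (graph_given_weights p n h)) A
     = ennreal (\<Sum>X\<in>?D \<inter> ?g -` A. \<Prod>e\<in>?V. pmf (case e of (i,j) \<Rightarrow> bernoulli_pmf (p (h i) (h j))) (X e))" for h
  proof -
    let ?P = "Pi_pmf ?V False (\<lambda>(i, j). bernoulli_pmf (p (h i) (h j)))"
    have "emeasure (measure_pmf (graph_given_weights p n h)) A = emeasure (measure_pmf ?P) (?g -` A)"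
      by (simp add: graph_given_weights_def)
    also have "\<dots> = emeasure (measure_pmf ?P) (?D \<inter> ?g -` A)"
    proof (rule emeasure_eq_AE)
      have "set_pmf ?P \<subseteq> ?D" 
        using set_Pi_pmf_subset[OF fV, of False] by (auto simp: PiE_dflt_def) 
      then show "AE x in ?P. (x \<in> ?g -` A) = (x \<in> ?D \<inter> ?g -` A)"
        by (auto simp: AE_measure_pmf_iff)
    qed auto
    also have "\<dots> = ennreal (\<Sum>X\<in>?D \<inter> ?g -` A. pmf ?P X)"
      using fD by (subst emeasure_measure_pmf_finite) auto
    also have "(\<Sum>X\<in>?D \<inter> ?g -` A. pmf ?P X) = (\<Sum>X\<in>?D \<inter> ?g -` A. \<Prod>e\<in>?V. pmf (case e of (i,j) \<Rightarrow> bernoulli_pmf (p (h i) (h j))) (X e))"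
      by (intro sum.cong refl) (subst pmf_Pi[OF fV], auto simp: PiE_dflt_def)
    finally show ?thesis .
  qed
  moreover have "(\<lambda>h. pmf (case e of (i,j) \<Rightarrow> bernoulli_pmf (p (h i) (h j))) (X e)) \<in> borel_measurable (weights_law \<tau> n)" if "e \<in> ?V" for e X
    using that m by (cases e; cases "X e") (auto simp: pm intro!: borel_measurable_min borel_measurable_max borel_measurable_diff)
  ultimately show "(\<lambda>h. emeasure (measure_pmf (graph_given_weights p n h)) A) \<in> borel_measurable (weights_law \<tau> n)"
    by (auto intro!: borel_measurable_sum borel_measurable_prod)
qed (auto intro: measure_pmf.subprob_space_axioms)

lemma measurable_conn_prob:
  assumes "continuous_on {0..} f" "i \<in> {1..n}" "j \<in> {1..n}"
  shows "(\<lambda>h. conn_prob \<tau> f n (h i) (h j)) \<in> borel_measurable (weights_law \<sigma> n)"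
proof -
  have c: "(\<lambda>h. h i) \<in> weights_law \<sigma> n \<rightarrow>\<^sub>M borel" if "i \<in> {1..n}" for i
    using measurable_component_singleton[OF that, of "\<lambda>_. weight_law \<sigma>"]
    unfolding weights_law_def weight_law_def
    by (rule measurable_compose) (auto intro!: measurable_restrict_space1)
  have "(\<lambda>h. h i * h j / (gam \<tau> n)\<^sup>2) \<in> weights_law \<sigma> n \<rightarrow>\<^sub>M restrict_space borel {0..}"
  proof (rule measurable_restrict_space2)
    show "(\<lambda>h. h i * h j / (gam \<tau> n)\<^sup>2) \<in> space (weights_law \<sigma> n) \<rightarrow> {0..}"
    proof
      fix h assume "h \<in> space (weights_law \<sigma> n)"
      then have "h i \<ge> 1" "h j \<ge> 1" using assms by (auto simp: weights_law_def space_PiM space_weight_law PiE_def Pi_def)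
      then show "h i * h j / (gam \<tau> n)\<^sup>2 \<in> {0..}" by simp
    qed
    show "(\<lambda>h. h i * h j / (gam \<tau> n)\<^sup>2) \<in> borel_measurable (weights_law \<sigma> n)"
      using c[OF assms(2)] c[OF assms(3)] by measurable
  qed
  from measurable_compose[OF this borel_measurable_continuous_on_restrict[OF assms(1)]]
  show ?thesis by (simp add: conn_prob_def)
qed

lemma prob_space_inhom_random_graph:
  assumes "continuous_on {0..} f" "1 < \<tau>"
  shows "prob_space (inhom_random_graph \<tau> (conn_prob \<tau> f n) n)"
proof -
  interpret W: prob_space "weights_law \<tau> n"
    unfolding weights_law_def using prob_space_weight_law[OF assms(2)] by (intro prob_space_PiM)
  show ?thesis unfolding inhom_random_graph_def
    by (rule W.prob_space_bind[OF _ measurable_graph_given_weights])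
       (auto intro!: measurable_conn_prob assms measure_pmf.prob_space_axioms simp: vertex_pairs_def)
qed

end

theory Submission
  imports Defs
begin

text \<open>The mean number of \<open>k\<close>-cycles is the number of \<open>k\<close>-cycles of the complete graph times the
  trace of the \<open>k\<close>-th power of the integral kernel \<open>f (h h' / \<gamma>\<^sup>2)\<close> with respect to the weight law.
  In the coordinate \<open>h = \<gamma> e\<^sup>u\<close> the kernel becomes, up to scalar factors, \<open>F (u + v)\<close> with
  \<open>F s = e\<^bsup>(1 - \<tau>) s / 2\<^esup> f (e\<^sup>s)\<close>, restricted to \<open>u, v \<ge> - ln \<gamma>\<close>; the restriction disappears
  monotonically as \<open>\<gamma> \<rightarrow> \<infinity>\<close>. For odd \<open>k\<close> the \<open>k\<close>-th power of \<open>F (u + v)\<close> is again of the form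
  \<open>G (u + v)\<close>, with \<open>\<integral> G = (\<integral> F)\<^sup>k\<close>, so its trace \<open>\<integral> G (2 u) du\<close> equals \<open>(\<integral> F)\<^sup>k / 2\<close>. Finally
  \<open>\<integral> F\<close> is the integral of the statement after substituting \<open>x = e\<^sup>s\<close>.\<close>

section \<open>Powers of integral kernels\<close>

text \<open>\<open>ker_pow M J m\<close> is the kernel of the operator power of exponent \<open>m + 1\<close>.\<close>

primrec ker_pow :: "'a measure \<Rightarrow> ('a \<Rightarrow> 'a \<Rightarrow> ennreal) \<Rightarrow> nat \<Rightarrow> 'a \<Rightarrow> 'a \<Rightarrow> ennreal" where
  "ker_pow M J 0 = J"
| "ker_pow M J (Suc m) = (\<lambda>a b. \<integral>\<^sup>+u. ker_pow M J m a u * J u b \<partial>M)"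

lemma measurable_ker_pow:
  assumes "sigma_finite_measure M"
    and J: "case_prod J \<in> borel_measurable (M \<Otimes>\<^sub>M M)"
  shows "case_prod (ker_pow M J m) \<in> borel_measurable (M \<Otimes>\<^sub>M M)"
proof (induction m)
  case (Suc m)
  interpret sigma_finite_measure M by fact
  note [measurable] = J Suc.IH
  have "(\<lambda>(x, u). ker_pow M J m (fst x) u * J u (snd x)) \<in> borel_measurable ((M \<Otimes>\<^sub>M M) \<Otimes>\<^sub>M M)"
    by measurable
  from borel_measurable_nn_integral[OF this] show ?case
    by (simp add: case_prod_beta')
qed (use J in simp)

text \<open>The weight \<open>g\<close> on the two endpoints is left arbitrary so that the induction
  closes: integrating out the last coordinate replaces \<open>g a b\<close> by
  \<open>\<integral>\<^sup>+w. J b w * g a w \<partial>M\<close>, again a function of the two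
  endpoints of the shorter chain.\<close>

lemma nn_integral_PiM_chain:
  assumes "sigma_finite_measure M"
    and J: "case_prod J \<in> borel_measurable (M \<Otimes>\<^sub>M M)"
    and g: "case_prod g \<in> borel_measurable (M \<Otimes>\<^sub>M M)"
  shows "(\<integral>\<^sup>+x. (\<Prod>i<Suc m. J (x i) (x (Suc i))) * g (x 0) (x (Suc m)) \<partial>PiM {..Suc m} (\<lambda>_. M))
       = (\<integral>\<^sup>+a. \<integral>\<^sup>+b. ker_pow M J m a b * g a b \<partial>M \<partial>M)"
  using g
proof (induction m arbitrary: g)
  case 0
  interpret sigma_finite_measure M by fact
  interpret product_sigma_finite "\<lambda>_::nat. M" by standard
  note [measurable] = J 0
  have "{..Suc 0} = {0, Suc 0}" by auto
  then have "(\<integral>\<^sup>+x. (\<Prod>i<Suc 0. J (x i) (x (Suc i))) * g (x 0) (x (Suc 0)) \<partial>PiM {..Suc 0} (\<lambda>_. M))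
      = (\<integral>\<^sup>+z. J (fst z) (snd z) * g (fst z) (snd z) \<partial>(M \<Otimes>\<^sub>M M))"
    by (simp add: product_nn_integral_pair[of "\<lambda>a b. J a b * g a b" 0 "Suc 0"])
  also have "\<dots> = (\<integral>\<^sup>+a. \<integral>\<^sup>+b. J a b * g a b \<partial>M \<partial>M)"
    by (subst nn_integral_fst[symmetric]) (simp_all add: case_prod_beta')
  finally show ?case by simp
next
  case (Suc m)
  interpret sigma_finite_measure M by fact
  interpret PP: pair_sigma_finite M M by standard
  interpret product_sigma_finite "\<lambda>_::nat. M" by standard
  note [measurable] = J Suc.prems
  note [measurable] = measurable_ker_pow[OF assms(1) J, of m]
  have mJ: "(\<lambda>x. J (x i) (x j)) \<in> borel_measurable (PiM I (\<lambda>_. M))" if "i \<in> I" "j \<in> I" for i j :: nat and I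
    using that by measurable
  have mg: "(\<lambda>x. g (x i) (x j)) \<in> borel_measurable (PiM I (\<lambda>_. M))" if "i \<in> I" "j \<in> I" for i j :: nat and I
    using that by measurable
  have "(\<lambda>(p, w). J (snd p) w * g (fst p) w) \<in> borel_measurable ((M \<Otimes>\<^sub>M M) \<Otimes>\<^sub>M M)"
    by measurable
  then have g': "case_prod (\<lambda>a b. \<integral>\<^sup>+w. J b w * g a w \<partial>M) \<in> borel_measurable (M \<Otimes>\<^sub>M M)"
    by (auto dest!: borel_measurable_nn_integral simp: case_prod_beta')
  have "{..Suc (Suc m)} = insert (Suc (Suc m)) {..Suc m}" by auto
  then have "(\<integral>\<^sup>+x. (\<Prod>i<Suc (Suc m). J (x i) (x (Suc i))) * g (x 0) (x (Suc (Suc m))) \<partial>PiM {..Suc (Suc m)} (\<lambda>_. M))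
     = (\<integral>\<^sup>+x. \<integral>\<^sup>+w. (\<Prod>i<Suc m. J (x i) (x (Suc i))) * (J (x (Suc m)) w * g (x 0) w) \<partial>M \<partial>PiM {..Suc m} (\<lambda>_. M))"
    by (simp only:, subst product_nn_integral_insert)
       (auto intro!: borel_measurable_times_ennreal borel_measurable_prod mJ mg simp: mult_ac)
  also have "\<dots> = (\<integral>\<^sup>+x. (\<Prod>i<Suc m. J (x i) (x (Suc i))) * (\<integral>\<^sup>+w. J (x (Suc m)) w * g (x 0) w \<partial>M) \<partial>PiM {..Suc m} (\<lambda>_. M))"
    by (intro nn_integral_cong nn_integral_cmult) (auto simp: space_PiM PiE_def Pi_def)
  also have "\<dots> = (\<integral>\<^sup>+a. \<integral>\<^sup>+b. ker_pow M J m a b * (\<integral>\<^sup>+w. J b w * g a w \<partial>M) \<partial>M \<partial>M)"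
    by (rule Suc.IH[OF g'])
  also have "\<dots> = (\<integral>\<^sup>+a. \<integral>\<^sup>+b. \<integral>\<^sup>+w. ker_pow M J m a b * (J b w * g a w) \<partial>M \<partial>M \<partial>M)"
    by (intro nn_integral_cong nn_integral_cmult[symmetric]) auto
  also have "\<dots> = (\<integral>\<^sup>+a. \<integral>\<^sup>+w. \<integral>\<^sup>+b. ker_pow M J m a b * (J b w * g a w) \<partial>M \<partial>M \<partial>M)"
    by (intro nn_integral_cong PP.Fubini') measurable
  \<comment> \<open>With the integral over \<open>b\<close> innermost and \<open>g a w\<close> free
    of \<open>b\<close>, the inner integral is the recursion step of \<open>ker_pow\<close>.\<close>
  also have "\<dots> = (\<integral>\<^sup>+a. \<integral>\<^sup>+w. \<integral>\<^sup>+b. (ker_pow M J m a b * J b w) * g a w \<partial>M \<partial>M \<partial>M)"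
    by (simp add: mult_ac)
  also have "\<dots> = (\<integral>\<^sup>+a. \<integral>\<^sup>+w. (\<integral>\<^sup>+b. ker_pow M J m a b * J b w \<partial>M) * g a w \<partial>M \<partial>M)"
    by (intro nn_integral_cong nn_integral_multc) auto
  finally show ?case by simp
qed

text \<open>A cycle is a chain whose endpoint weight is the closing edge,
  \<open>g a b = J b a\<close>. Integrating that edge over \<open>b\<close> turns the chain kernel
  into the next power on the diagonal.\<close>

lemma nn_integral_PiM_cycle:
  assumes M: "sigma_finite_measure M"
    and J: "case_prod J \<in> borel_measurable (M \<Otimes>\<^sub>M M)"
  shows "(\<integral>\<^sup>+x. (\<Prod>i<Suc (Suc m). J (x i) (x (Suc i mod Suc (Suc m)))) \<partial>PiM {..<Suc (Suc m)} (\<lambda>_. M))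
       = (\<integral>\<^sup>+a. ker_pow M J (Suc m) a a \<partial>M)"
proof -
  have g: "(\<lambda>(a, b). J b a) \<in> borel_measurable (M \<Otimes>\<^sub>M M)"
    using measurable_compose[OF measurable_pair_swap' J] by (simp add: case_prod_beta')
  have "(\<Prod>i<Suc (Suc m). J (x i) (x (Suc i mod Suc (Suc m)))) =
     (\<Prod>i<Suc m. J (x i) (x (Suc i))) * J (x (Suc m)) (x 0)" for x
    unfolding prod.lessThan_Suc[of _ "Suc m"] by (intro arg_cong2[of _ _ _ _ "(*)"] prod.cong) auto
  then show ?thesis
    using nn_integral_PiM_chain[OF M J g, of m] by (simp add: lessThan_Suc_atMost del: prod.lessThan_Suc)
qed

lemma ker_pow_mono:
  assumes "\<And>a b. J a b \<le> J' a b"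
  shows "ker_pow M J m a b \<le> ker_pow M J' m a b"
  by (induction m arbitrary: a b) (auto intro!: assms nn_integral_mono mult_mono)

text \<open>Monotone convergence is applied once per integral. The kernels become eventually equal
  to a finite limit, which is stronger than convergence: the powers may be infinite, and
  multiplication on \<open>ennreal\<close> is continuous only when one factor is fixed and
  finite.\<close>

lemma ker_pow_LIMSEQ:
  assumes M: "sigma_finite_measure M"
    and meas: "\<And>n. case_prod (J n) \<in> borel_measurable (M \<Otimes>\<^sub>M M)"
    and mono: "\<And>n a b. J n a b \<le> J (Suc n) a b"
    and lim: "\<And>a b. eventually (\<lambda>n. J n a b = J' a b) sequentially"
    and fin: "\<And>a b. J' a b < \<top>"
    and sp: "space M = UNIV"
  shows "(\<lambda>n. ker_pow M (J n) m a b) \<longlonglongrightarrow> ker_pow M J' m a b"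
proof (induction m arbitrary: a b)
  case 0
  show ?case using tendsto_eventually[OF lim] by simp
next
  case (Suc m)
  note [measurable] = meas measurable_ker_pow[OF M meas]
  show ?case
    unfolding ker_pow.simps
  proof (rule nn_integral_LIMSEQ)
    show "incseq (\<lambda>n u. ker_pow M (J n) m a u * J n u b)"
      by (intro incseq_SucI le_funI mult_mono ker_pow_mono mono) auto
    show "(\<lambda>u. ker_pow M (J n) m a u * J n u b) \<in> borel_measurable M" for n
      using measurable_Pair2[OF measurable_ker_pow[OF M meas], of a n m] measurable_Pair1[OF meas, of b n] sp
      by simp
    fix u
    have "(\<lambda>n. J' u b * ker_pow M (J n) m a u) \<longlonglongrightarrow> J' u b * ker_pow M J' m a u"
      by (rule ennreal_tendsto_cmult[OF fin Suc.IH])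
    moreover have "\<forall>\<^sub>F n in sequentially. J' u b * ker_pow M (J n) m a u = ker_pow M (J n) m a u * J n u b"
      using lim[of u b] by eventually_elim (simp add: mult.commute)
    ultimately show "(\<lambda>n. ker_pow M (J n) m a u * J n u b) \<longlonglongrightarrow> ker_pow M J' m a u * J' u b"
      using Lim_transform_eventually by (fastforce simp: mult.commute)
  qed
qed

text \<open>The density of the substitution is written as a square \<open>w u * w u\<close>, so that
  every inner variable can give one factor \<open>w\<close> to each of its two adjacent edges. The
  new kernel stays symmetric if \<open>J\<close> is, and each of the \<open>m\<close> inner
  integrals contributes one constant \<open>A\<close>.\<close>

lemma ker_pow_change_of_variables:
  assumes M: "sigma_finite_measure M" and N: "sigma_finite_measure N"
    and J: "case_prod J \<in> borel_measurable (M \<Otimes>\<^sub>M M)"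
    and sp: "\<And>u. T u \<in> space M" "space N = UNIV"
    and T: "T \<in> N \<rightarrow>\<^sub>M M" and w: "w \<in> borel_measurable N"
    and cov: "\<And>\<phi>. \<phi> \<in> borel_measurable M \<Longrightarrow>
               (\<integral>\<^sup>+h. \<phi> h \<partial>M) = A * (\<integral>\<^sup>+u. \<phi> (T u) * (w u * w u) \<partial>N)"
  shows "w a * ker_pow M J m (T a) (T b) * w b =
         A ^ m * ker_pow N (\<lambda>u v. w u * J (T u) (T v) * w v) m a b"
proof (induction m arbitrary: a b)
  case (Suc m)
  note [measurable] = T w J measurable_ker_pow[OF M J, of m] sp(1)
  let ?J' = "\<lambda>u v. w u * J (T u) (T v) * w v"
  have J': "case_prod ?J' \<in> borel_measurable (N \<Otimes>\<^sub>M N)"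
    by measurable
  have "(\<lambda>u. ker_pow N ?J' m a u * ?J' u b) \<in> borel_measurable N"
    using measurable_Pair2[OF measurable_ker_pow[OF N J'], of a m] measurable_Pair1[OF J', of b] sp
    by simp
  then have "(\<integral>\<^sup>+u. A ^ m * (ker_pow N ?J' m a u * ?J' u b) \<partial>N) = A ^ m * ker_pow N ?J' (Suc m) a b"
    by (simp add: nn_integral_cmult)
  note scale = this
  have "w a * ker_pow M J (Suc m) (T a) (T b) * w b
      = A * (w a * w b * (\<integral>\<^sup>+u. ker_pow M J m (T a) (T u) * J (T u) (T b) * (w u * w u) \<partial>N))"
    by (simp add: cov mult_ac)
  also have "w a * w b * (\<integral>\<^sup>+u. ker_pow M J m (T a) (T u) * J (T u) (T b) * (w u * w u) \<partial>N)
      = (\<integral>\<^sup>+u. (w a * w b) * (ker_pow M J m (T a) (T u) * J (T u) (T b) * (w u * w u)) \<partial>N)"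
    by (rule nn_integral_cmult[symmetric]) measurable
  also have "\<dots> = (\<integral>\<^sup>+u. (w a * ker_pow M J m (T a) (T u) * w u) * ?J' u b \<partial>N)"
    by (simp add: mult_ac)
  also have "\<dots> = (\<integral>\<^sup>+u. A ^ m * ker_pow N ?J' m a u * ?J' u b \<partial>N)"
    by (simp only: Suc.IH)
  also have "\<dots> = (\<integral>\<^sup>+u. A ^ m * (ker_pow N ?J' m a u * ?J' u b) \<partial>N)"
    by (simp only: mult.assoc)
  also have "A * \<dots> = A ^ Suc m * ker_pow N ?J' (Suc m) a b"
    by (simp only: scale power_Suc) (simp only: mult.assoc)
  finally show ?case .
qed simp

section \<open>Kernels depending on the sum of the arguments\<close>

text \<open>Iterated cross-correlation rather than convolution: the variable \<open>v\<close> enters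
  \<open>F\<close> with a plus sign, as dictated by kernels in \<open>u + v\<close>.\<close>

primrec corr_pow :: "(real \<Rightarrow> ennreal) \<Rightarrow> nat \<Rightarrow> real \<Rightarrow> ennreal" where
  "corr_pow F 0 = F"
| "corr_pow F (Suc m) = (\<lambda>s. \<integral>\<^sup>+v. corr_pow F m v * F (v + s) \<partial>lborel)"

lemma measurable_corr_pow [measurable]:
  assumes [measurable]: "F \<in> borel_measurable borel"
  shows "corr_pow F m \<in> borel_measurable borel"
proof (induction m)
  case (Suc m)
  note [measurable] = Suc
  show ?case by simp
qed simp

lemma nn_integral_lborel_translate:
  fixes c :: real
  assumes "g \<in> borel_measurable borel"
  shows "(\<integral>\<^sup>+x. g (x + c) \<partial>lborel) = (\<integral>\<^sup>+x. g x \<partial>lborel)"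
  using nn_integral_real_affine[OF assms, of 1 c] by (simp add: add.commute)

text \<open>By Tonelli and translation invariance total mass is multiplicative under correlation,
  just as under convolution.\<close>

lemma nn_integral_corr_pow:
  fixes F :: "real \<Rightarrow> ennreal"
  assumes F [measurable]: "F \<in> borel_measurable borel"
  shows "(\<integral>\<^sup>+s. corr_pow F m s \<partial>lborel) = (\<integral>\<^sup>+s. F s \<partial>lborel) ^ Suc m"
proof (induction m)
  case (Suc m)
  have "(\<integral>\<^sup>+s. corr_pow F (Suc m) s \<partial>lborel) = (\<integral>\<^sup>+v. \<integral>\<^sup>+s. corr_pow F m v * F (v + s) \<partial>lborel \<partial>lborel)"
    unfolding corr_pow.simps by (rule lborel_pair.Fubini') measurable
  also have "\<dots> = (\<integral>\<^sup>+v. corr_pow F m v * (\<integral>\<^sup>+s. F s \<partial>lborel) \<partial>lborel)"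
    using nn_integral_lborel_translate[OF F]
    by (intro nn_integral_cong) (simp add: nn_integral_cmult add.commute[of _ "_ :: real"])
  also have "\<dots> = (\<integral>\<^sup>+s. F s \<partial>lborel) ^ Suc (Suc m)"
    by (subst nn_integral_multc) (simp_all add: Suc.IH mult.commute)
  finally show ?case .
qed simp

text \<open>Shifting the integration variable absorbs the dependence on \<open>a\<close>, and each
  further factor flips the sign with which \<open>a\<close> occurs. Odd powers of the operator
  (\<open>m\<close> even) thus depend on \<open>a + b\<close>, even powers on
  \<open>b - a\<close>.\<close>

lemma ker_pow_lborel:
  fixes F :: "real \<Rightarrow> ennreal"
  assumes F [measurable]: "F \<in> borel_measurable borel"
  shows "ker_pow lborel (\<lambda>a b. F (a + b)) m a b = corr_pow F m (b + (- 1) ^ m * a)"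
proof (induction m arbitrary: a b)
  case (Suc m)
  \<comment> \<open>With \<open>u + e\<close> as the new variable the last factor reads
    \<open>F (v + (b - e))\<close>, which is where the sign alternates.\<close>
  define e where "e = (- 1) ^ m * a"
  have "ker_pow lborel (\<lambda>a b. F (a + b)) (Suc m) a b
      = (\<integral>\<^sup>+u. corr_pow F m (u + e) * F ((u + e) + (b - e)) \<partial>lborel)"
    by (simp add: Suc.IH e_def)
  also have "\<dots> = (\<integral>\<^sup>+v. corr_pow F m v * F (v + (b - e)) \<partial>lborel)"
    by (rule nn_integral_lborel_translate[where g = "\<lambda>v. corr_pow F m v * F (v + (b - e))"]) measurable
  finally show ?case by (simp add: e_def)
qed (simp add: add.commute)

text \<open>For even \<open>m\<close> the diagonal value is \<open>corr_pow F m (2 * u)\<close>, and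
  rescaling by 2 costs a factor one half. For odd \<open>m\<close> the diagonal would be constant in
  \<open>u\<close>; this is where odd cycle lengths differ from even ones.\<close>

lemma trace_ker_pow_lborel:
  fixes F :: "real \<Rightarrow> ennreal"
  assumes F [measurable]: "F \<in> borel_measurable borel" and "even m"
  shows "2 * (\<integral>\<^sup>+u. ker_pow lborel (\<lambda>a b. F (a + b)) m u u \<partial>lborel) = (\<integral>\<^sup>+s. F s \<partial>lborel) ^ Suc m"
  using nn_integral_real_affine[of "corr_pow F m" 2 0] \<open>even m\<close>
  by (simp add: ker_pow_lborel nn_integral_corr_pow[OF F, symmetric] del: power_Suc)

section \<open>Logarithmic coordinates\<close>

lemma eventually_ge_real_Suc: "\<forall>\<^sub>F n in sequentially. c \<le> real (Suc n)"
proof -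
  obtain N where "c \<le> real N" using real_arch_simple by blast
  then show ?thesis by (intro eventually_sequentiallyI[of N]) auto
qed

text \<open>The substitution is made on compact intervals exhausting both domains; monotone
  convergence identifies the limit of the same sequence \<open>L\<close> in two ways. Using
  \<open>Suc n\<close> keeps the intervals nondegenerate already at \<open>n = 0\<close>.\<close>

lemma nn_integral_exp_substitution:
  assumes [measurable]: "\<phi> \<in> borel_measurable borel"
  shows "(\<integral>\<^sup>+x. \<phi> x * indicator {0<..} x \<partial>lborel) = (\<integral>\<^sup>+u. \<phi> (exp u) * ennreal (exp u) \<partial>lborel)"
proof (rule LIMSEQ_unique)
  define L where "L = (\<lambda>n::nat. \<integral>\<^sup>+x. \<phi> x * indicator {exp (- real (Suc n))..exp (real (Suc n))} x \<partial>lborel)"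
  show "L \<longlonglongrightarrow> (\<integral>\<^sup>+x. \<phi> x * indicator {0<..} x \<partial>lborel)"
    unfolding L_def
  proof (rule nn_integral_LIMSEQ)
    show "incseq (\<lambda>n x. \<phi> x * indicator {exp (- real (Suc n))..exp (real (Suc n))} x)"
      by (intro incseq_SucI le_funI mult_left_mono) (auto simp: indicator_def intro: order_trans order_trans[rotated])
    fix x :: real
    have "\<forall>\<^sub>F n in sequentially. \<bar>ln x\<bar> \<le> real (Suc n)"
      by (rule eventually_ge_real_Suc)
    then have "\<forall>\<^sub>F n in sequentially. \<phi> x * indicator {0<..} x = \<phi> x * indicator {exp (- real (Suc n))..exp (real (Suc n))} x"
    proof eventually_elim
      case (elim n)
      show ?case
      proof (cases "x > 0")
        case True
        then have "exp (- real (Suc n)) \<le> x" "x \<le> exp (real (Suc n))"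
          using elim exp_le_cancel_iff[of "- real (Suc n)" "ln x"] exp_le_cancel_iff[of "ln x" "real (Suc n)"]
          by (simp_all add: abs_le_iff del: exp_le_cancel_iff of_nat_Suc)
        then show ?thesis using True by simp
      next
        case False
        then show ?thesis by (auto simp: indicator_def dest: order_less_le_trans[OF exp_gt_zero])
      qed
    qed
    then show "(\<lambda>n. \<phi> x * indicator {exp (- real (Suc n))..exp (real (Suc n))} x) \<longlonglongrightarrow> \<phi> x * indicator {0<..} x"
      by (rule Lim_transform_eventually[rotated]) simp
  qed simp
  have L: "L = (\<lambda>n. \<integral>\<^sup>+u. \<phi> (exp u) * ennreal (exp u) * indicator {- real (Suc n)..real (Suc n)} u \<partial>lborel)"
    unfolding L_def by (intro ext nn_integral_substitution_aux) (auto intro!: derivative_eq_intros continuous_intros)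
  show "L \<longlonglongrightarrow> (\<integral>\<^sup>+u. \<phi> (exp u) * ennreal (exp u) \<partial>lborel)"
    unfolding L
  proof (rule nn_integral_LIMSEQ)
    show "incseq (\<lambda>n u. \<phi> (exp u) * ennreal (exp u) * indicator {- real (Suc n)..real (Suc n)} u)"
      by (intro incseq_SucI le_funI mult_left_mono) (auto simp: indicator_def)
    fix u :: real
    have "\<forall>\<^sub>F n in sequentially. \<bar>u\<bar> \<le> real (Suc n)"
      by (rule eventually_ge_real_Suc)
    then have "\<forall>\<^sub>F n in sequentially. \<phi> (exp u) * ennreal (exp u) = \<phi> (exp u) * ennreal (exp u) * indicator {- real (Suc n)..real (Suc n)} u"
      by eventually_elim (auto simp: indicator_def)
    then show "(\<lambda>n. \<phi> (exp u) * ennreal (exp u) * indicator {- real (Suc n)..real (Suc n)} u) \<longlonglongrightarrow> \<phi> (exp u) * ennreal (exp u)"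
      by (rule Lim_transform_eventually[rotated]) simp
  qed simp
qed

lemma measurable_weight_law_iff:
  fixes \<phi> :: "real \<Rightarrow> ennreal"
  shows "\<phi> \<in> borel_measurable (weight_law \<tau>) \<longleftrightarrow> (\<lambda>h. \<phi> h * indicator {1..} h) \<in> borel_measurable borel"
  unfolding weight_law_def
  by (simp add: measurable_density_eq1 borel_measurable_restrict_space_iff_ennreal)

text \<open>Substituting \<open>h = c * exp u\<close> turns
  \<open>(\<tau> - 1) * h powr (- \<tau>)\<close> times \<open>dh\<close> into a constant times
  \<open>exp ((1 - \<tau>) * u)\<close> times \<open>du\<close>. The exponential is split into two
  equal factors to fit \<open>ker_pow_change_of_variables\<close>. The \<open>max\<close> keeps the
  argument in \<open>{1..}\<close> for every real \<open>u\<close>; it changes nothing where the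
  indicator is 1.\<close>

lemma nn_integral_weight_law:
  assumes phi: "\<phi> \<in> borel_measurable (weight_law \<tau>)" and c: "0 < c" and tau: "1 < \<tau>"
  shows "(\<integral>\<^sup>+h. \<phi> h \<partial>weight_law \<tau>) = ennreal ((\<tau> - 1) * c powr (1 - \<tau>)) *
     (\<integral>\<^sup>+u. \<phi> (max 1 (c * exp u)) * ((indicator {- ln c..} u * ennreal (exp ((1 - \<tau>) * u / 2))) *
        (indicator {- ln c..} u * ennreal (exp ((1 - \<tau>) * u / 2)))) \<partial>lborel)"
proof -
  define \<psi> where "\<psi> h = (\<phi> h * indicator {1..} h) * ennreal ((\<tau> - 1) * h powr (- \<tau>))" for h
  have [measurable]: "(\<lambda>h. \<phi> h * indicator {1..} h) \<in> borel_measurable borel"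
    using phi by (simp add: measurable_weight_law_iff)
  have [measurable]: "\<psi> \<in> borel_measurable borel"
    unfolding \<psi>_def by measurable
  have "(\<integral>\<^sup>+h. \<phi> h \<partial>weight_law \<tau>) = (\<integral>\<^sup>+h. ennreal ((\<tau> - 1) * h powr (- \<tau>)) * \<phi> h \<partial>restrict_space lborel {1..})"
    using phi unfolding weight_law_def
    by (subst nn_integral_density) (auto intro!: measurable_restrict_space1)
  also have "\<dots> = (\<integral>\<^sup>+h. \<psi> h * indicator {0<..} h \<partial>lborel)"
    by (subst nn_integral_restrict_space) (auto simp: \<psi>_def indicator_def mult_ac intro!: nn_integral_cong)
  also have "\<dots> = (\<integral>\<^sup>+u. \<psi> (exp u) * ennreal (exp u) \<partial>lborel)"
    by (rule nn_integral_exp_substitution) measurable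
  also have "\<dots> = (\<integral>\<^sup>+u. \<psi> (exp (u + ln c)) * ennreal (exp (u + ln c)) \<partial>lborel)"
    by (rule nn_integral_lborel_translate[symmetric]) measurable
  also have "\<dots> = (\<integral>\<^sup>+u. ennreal ((\<tau> - 1) * c powr (1 - \<tau>)) *
        (\<phi> (max 1 (c * exp u)) * ((indicator {- ln c..} u * ennreal (exp ((1 - \<tau>) * u / 2))) *
        (indicator {- ln c..} u * ennreal (exp ((1 - \<tau>) * u / 2))))) \<partial>lborel)"
  proof (rule nn_integral_cong)
    fix u :: real
    have e: "exp (u + ln c) = c * exp u" using c by (simp add: exp_add)
    have i: "(indicator {1..} (c * exp u) :: ennreal) = indicator {- ln c..} u"
    proof -
      have "1 \<le> c * exp u \<longleftrightarrow> - ln c \<le> u"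
        unfolding e[symmetric] by auto
      then show ?thesis by (simp add: indicator_def)
    qed
    have "(c * exp u) powr (- \<tau>) * (c * exp u) = c powr (1 - \<tau>) * exp ((1 - \<tau>) * u)"
      using c by (simp add: powr_def exp_add[symmetric] ln_mult exp_diff exp_minus field_simps e[symmetric])
    also have "exp ((1 - \<tau>) * u) = exp ((1 - \<tau>) * u / 2) * exp ((1 - \<tau>) * u / 2)"
      by (simp add: exp_add[symmetric])
    finally have p: "(\<tau> - 1) * (c * exp u) powr (- \<tau>) * (c * exp u)
        = ((\<tau> - 1) * c powr (1 - \<tau>)) * (exp ((1 - \<tau>) * u / 2) * exp ((1 - \<tau>) * u / 2))"
      by (simp add: mult.assoc)
    have q: "ennreal ((\<tau> - 1) * (c * exp u) powr (- \<tau>)) * ennreal (c * exp u)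
      = ennreal ((\<tau> - 1) * c powr (1 - \<tau>)) * (ennreal (exp ((1 - \<tau>) * u / 2)) * ennreal (exp ((1 - \<tau>) * u / 2)))"
      using arg_cong[OF p, of ennreal] c tau by (simp add: ennreal_mult' ennreal_mult'')
    show "\<psi> (exp (u + ln c)) * ennreal (exp (u + ln c)) = ennreal ((\<tau> - 1) * c powr (1 - \<tau>)) *
        (\<phi> (max 1 (c * exp u)) * ((indicator {- ln c..} u * ennreal (exp ((1 - \<tau>) * u / 2))) *
        (indicator {- ln c..} u * ennreal (exp ((1 - \<tau>) * u / 2)))))"
    proof (cases "- ln c \<le> u")
      case True
      then have "1 \<le> c * exp u" using i by (auto simp: indicator_def split: if_splits)
      then have "max 1 (c * exp u) = c * exp u" by simp
      then show ?thesis unfolding \<psi>_def e i mult.assoc using True q by (simp add: mult_ac)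
    next
      case False
      then show ?thesis unfolding \<psi>_def e i by simp
    qed
  qed
  also have "\<dots> = ennreal ((\<tau> - 1) * c powr (1 - \<tau>)) *
     (\<integral>\<^sup>+u. \<phi> (max 1 (c * exp u)) * ((indicator {- ln c..} u * ennreal (exp ((1 - \<tau>) * u / 2))) *
        (indicator {- ln c..} u * ennreal (exp ((1 - \<tau>) * u / 2)))) \<partial>lborel)"
  proof (rule nn_integral_cmult)
    \<comment> \<open>Only the extension of \<open>\<phi>\<close> by 0 is known to be Borel on the
      whole line; since the argument is at least 1, the inserted indicator equals 1.\<close>
    have "(\<lambda>u. \<phi> (max 1 (c * exp u))) = (\<lambda>u. (\<lambda>h. \<phi> h * indicator {1..} h) (max 1 (c * exp u)))"
      by auto
    also have "\<dots> \<in> borel_measurable borel"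
      by measurable
    finally have [measurable]: "(\<lambda>u. \<phi> (max 1 (c * exp u))) \<in> borel_measurable borel" .
    show "(\<lambda>u. \<phi> (max 1 (c * exp u)) * ((indicator {- ln c..} u * ennreal (exp ((1 - \<tau>) * u / 2))) *
        (indicator {- ln c..} u * ennreal (exp ((1 - \<tau>) * u / 2))))) \<in> borel_measurable lborel"
      by measurable
  qed
  finally show ?thesis .
qed

section \<open>Counting cycles\<close>

definition cycle_edges :: "nat \<Rightarrow> (nat \<Rightarrow> 'a) \<Rightarrow> 'a set set" where
  "cycle_edges k v = (\<lambda>i. {v i, v (Suc i mod k)}) ` {..<k}"

text \<open>These are rooted, oriented cycles. Extensionality outside \<open>{..<k}\<close> makes
  each of them a single function, so that they can be counted.\<close>

definition inj_seqs :: "nat \<Rightarrow> 'a set \<Rightarrow> (nat \<Rightarrow> 'a) set" where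
  "inj_seqs k A = {v \<in> {..<k} \<rightarrow>\<^sub>E A. inj_on v {..<k}}"

text \<open>Two positions with the same edge would be each other's cyclic successor, which is
  impossible once \<open>k\<close> is at least 3.\<close>

lemma inj_on_cycle_edge:
  assumes "3 \<le> k" "inj_on v {..<k}"
  shows "inj_on (\<lambda>i. {v i, v (Suc i mod k)}) {..<k}"
proof (rule inj_onI)
  fix i j assume ij: "i \<in> {..<k}" "j \<in> {..<k}" and eq: "{v i, v (Suc i mod k)} = {v j, v (Suc j mod k)}"
  have lt: "Suc i mod k < k" "Suc j mod k < k" using assms by auto
  show "i = j"
  proof (cases "v i = v j")
    case True
    then show ?thesis using ij assms by (auto dest: inj_onD)
  next
    case False
    then have "v i = v (Suc j mod k)" "v (Suc i mod k) = v j"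
      using eq by (auto simp: doubleton_eq_iff)
    then have "i = Suc j mod k" "Suc i mod k = j"
      using inj_onD[OF assms(2)] ij lt by auto
    then show ?thesis using ij assms by (auto simp: mod_Suc split: if_splits)
  qed
qed

lemma card_cycle_edges:
  assumes "3 \<le> k" "inj_on v {..<k}"
  shows "card (cycle_edges k v) = k"
  unfolding cycle_edges_def using card_image[OF inj_on_cycle_edge[OF assms]] by simp

text \<open>A walk around a cycle has no choice after its first directed edge: of the two edges at
  the current vertex, one leads back. The induction therefore carries two consecutive
  vertices.\<close>

lemma cycle_edges_determined:
  assumes k: "3 \<le> k" and v: "inj_on v {..<k}" and w: "inj_on w {..<k}"
    and eq: "cycle_edges k w = cycle_edges k v" and start: "w 0 = v 0" "w 1 = v 1"
    and i: "Suc i < k"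
  shows "w i = v i \<and> w (Suc i) = v (Suc i)"
  using i
proof (induction i)
  case 0
  then show ?case using start by simp
next
  case (Suc i)
  then have IH: "w i = v i" "w (Suc i) = v (Suc i)" by auto
  have "{w (Suc i), w (Suc (Suc i))} \<in> cycle_edges k w"
    unfolding cycle_edges_def using Suc.prems by (intro image_eqI[of _ _ "Suc i"]) auto
  then obtain j where j: "j < k" "{w (Suc i), w (Suc (Suc i))} = {v j, v (Suc j mod k)}"
    unfolding eq by (auto simp: cycle_edges_def)
  have ne: "w (Suc (Suc i)) \<noteq> w i"
    using inj_onD[OF w, of "Suc (Suc i)" i] Suc.prems by auto
  have "v (Suc i) = v j \<or> v (Suc i) = v (Suc j mod k)"
    using j(2) IH by (auto simp: doubleton_eq_iff)
  \<comment> \<open>The edge with index \<open>j\<close> meets \<open>v (Suc i)\<close>, so it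
    either leaves this vertex or is the edge by which the walk arrived; injectivity of
    \<open>w\<close> excludes the latter.\<close>
  then have "Suc i = j \<or> Suc i = Suc j mod k"
    using inj_onD[OF v, of "Suc i" j] inj_onD[OF v, of "Suc i" "Suc j mod k"] Suc.prems j(1) by auto
  then show ?case
  proof
    assume "Suc i = j"
    then show ?thesis using j(2) IH Suc.prems by (auto simp: doubleton_eq_iff)
  next
    assume "Suc i = Suc j mod k"
    then have "j = i" using j(1) by (auto simp: mod_Suc split: if_splits)
    then have "w (Suc (Suc i)) = w i"
      using j(2) IH Suc.prems by (auto simp: doubleton_eq_iff)
    then show ?thesis using ne by simp
  qed
qed

text \<open>The action of the dihedral group of order \<open>2 * k\<close>: \<open>j\<close> is the
  new root and \<open>b\<close> selects the orientation. The term \<open>k - i\<close> stands for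
  the residue of \<open>- i\<close> in natural numbers.\<close>

definition dihedral :: "nat \<Rightarrow> (nat \<Rightarrow> 'a) \<Rightarrow> bool \<times> nat \<Rightarrow> nat \<Rightarrow> 'a" where
  "dihedral k v = (\<lambda>(b, j). \<lambda>i\<in>{..<k}. v ((j + (if b then i else k - i)) mod k))"

lemma mod_add_left_cancel_less:
  fixes i j m k :: nat
  assumes "(m + i) mod k = (m + j) mod k" "i < k" "j < k"
  shows "i = j"
proof -
  have "i = j" if "(m + i) mod k = (m + j) mod k" "i < k" "j \<le> i" for i j
    using that mod_eq_dvd_iff_nat[of "m + j" "m + i" k] nat_dvd_not_less[of "i - j" k] by fastforce
  from this[of i j] this[of j i] show ?thesis
    using assms by (metis nat_le_linear)
qed

lemma dihedral_in_inj_seqs: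
  assumes k: "3 \<le> k" and v: "v \<in> inj_seqs k A"
  shows "dihedral k v (b, j) \<in> inj_seqs k A"
proof -
  have v': "v \<in> {..<k} \<rightarrow> A" "inj_on v {..<k}" using v by (auto simp: inj_seqs_def)
  have "inj_on (dihedral k v (b, j)) {..<k}"
  proof (rule inj_onI)
    fix x y assume xy: "x \<in> {..<k}" "y \<in> {..<k}" and eq: "dihedral k v (b, j) x = dihedral k v (b, j) y"
    then have m: "(j + (if b then x else k - x)) mod k = (j + (if b then y else k - y)) mod k"
      using inj_onD[OF v'(2)] k by (auto simp: dihedral_def split: if_splits)
    show "x = y"
    proof (cases b)
      case True
      then show ?thesis using mod_add_left_cancel_less[of j x k y] m xy by simp
    next
      case False
      \<comment> \<open>Adding \<open>x + y\<close> removes the truncated subtractions and exchanges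
        the roles of \<open>x\<close> and \<open>y\<close>.\<close>
      have "(j + (k - x) + (x + y)) mod k = (j + (k - y) + (x + y)) mod k"
        by (rule mod_add_cong[OF _ refl]) (use m False in simp)
      moreover have "j + (k - x) + (x + y) = (j + k) + y" "j + (k - y) + (x + y) = (j + k) + x"
        using xy by auto
      ultimately show ?thesis using mod_add_left_cancel_less[of "j + k" y k x] xy by (auto simp: add.assoc)
    qed
  qed
  then show ?thesis using v' k by (auto simp: inj_seqs_def dihedral_def Pi_def)
qed

text \<open>Both edge sets have \<open>k\<close> elements, so one inclusion is enough.\<close>

lemma cycle_edges_dihedral:
  assumes k: "3 \<le> k" and v: "v \<in> inj_seqs k A"
  shows "cycle_edges k (dihedral k v (b, j)) = cycle_edges k v"
proof (rule card_subset_eq)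
  show "finite (cycle_edges k v)" by (simp add: cycle_edges_def)
  show "card (cycle_edges k (dihedral k v (b, j))) = card (cycle_edges k v)"
    using dihedral_in_inj_seqs[OF k v, of b j] v card_cycle_edges[OF k, of v]
      card_cycle_edges[OF k, of "dihedral k v (b, j)"] by (simp add: inj_seqs_def)
  show "cycle_edges k (dihedral k v (b, j)) \<subseteq> cycle_edges k v"
  proof
    fix e assume "e \<in> cycle_edges k (dihedral k v (b, j))"
    then obtain i where i: "i < k" "e = {dihedral k v (b, j) i, dihedral k v (b, j) (Suc i mod k)}"
      by (auto simp: cycle_edges_def)
    have e: "e = {v ((j + (if b then i else k - i)) mod k), v ((j + (if b then Suc i mod k else k - Suc i mod k)) mod k)}"
      using i k by (simp add: dihedral_def)
    show "e \<in> cycle_edges k v"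
    proof (cases b)
      case True
      have "Suc ((j + i) mod k) mod k = (j + Suc i mod k) mod k"
        by (simp add: mod_simps)
      then show ?thesis unfolding cycle_edges_def using True e k
        by (intro image_eqI[of _ _ "(j + i) mod k"]) auto
    next
      case False
      \<comment> \<open>In the reversed walk the edge at position \<open>i\<close> is the original
        edge with index \<open>j + (k - Suc i)\<close> modulo \<open>k\<close>. The second fact
        covers the wrap-around, where \<open>k - 0\<close> and \<open>k - k\<close> agree modulo
        \<open>k\<close>.\<close>
      have 1: "Suc ((j + (k - Suc i)) mod k) mod k = (j + (k - i)) mod k"
        using i by (simp add: mod_Suc_eq Suc_diff_Suc)
      have 2: "(j + (k - Suc i mod k)) mod k = (j + (k - Suc i)) mod k"
        using i by (cases "Suc i = k") auto
      show ?thesis unfolding cycle_edges_def using False e k 1 2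
        by (intro image_eqI[of _ _ "(j + (k - Suc i)) mod k"]) auto
    qed
  qed
qed

text \<open>The sequences with a given edge set form one free orbit. Freeness: the first value
  determines the root and the second the orientation. Transitivity: some element matches the first
  directed edge of \<open>w\<close>, and \<open>cycle_edges_determined\<close> does the
  rest.\<close>

lemma bij_betw_dihedral:
  assumes k: "3 \<le> k" and v: "v \<in> inj_seqs k A"
  shows "bij_betw (dihedral k v) (UNIV \<times> {..<k}) {w \<in> inj_seqs k A. cycle_edges k w = cycle_edges k v}"
  unfolding bij_betw_def
proof
  have iv: "inj_on v {..<k}" using v by (auto simp: inj_seqs_def)
  have at0: "dihedral k v (b, j) 0 = v j" if "j < k" for b j
    using that k by (simp add: dihedral_def)
  have at1: "dihedral k v (b, j) 1 = v ((j + (if b then 1 else k - 1)) mod k)" for b j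
    using k by (simp add: dihedral_def)
  show "inj_on (dihedral k v) (UNIV \<times> {..<k})"
  proof (rule inj_onI, clarify)
    fix b b' :: bool and j j' assume jj: "j < k" "j' < k" and eq: "dihedral k v (b, j) = dihedral k v (b', j')"
    from fun_cong[OF eq, of 0] have j: "j = j'"
      using jj inj_onD[OF iv, of j j'] by (simp add: at0)
    have "(j + (if b then 1 else k - 1)) mod k = (j + (if b' then 1 else k - 1)) mod k"
      using fun_cong[OF eq, of 1] unfolding at1 j[symmetric] using k by (auto dest!: inj_onD[OF iv])
    \<comment> \<open>The residues 1 and \<open>k - 1\<close> differ because \<open>k\<close> is at
      least 3.\<close>
    from mod_add_left_cancel_less[OF this] have "b = b'"
      using k by (cases b; cases b') auto
    with j show "b = b' \<and> j = j'" by simp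
  qed
  show "dihedral k v ` (UNIV \<times> {..<k}) = {w \<in> inj_seqs k A. cycle_edges k w = cycle_edges k v}"
  proof (intro equalityI subsetI)
    fix w assume "w \<in> dihedral k v ` (UNIV \<times> {..<k})"
    then show "w \<in> {w \<in> inj_seqs k A. cycle_edges k w = cycle_edges k v}"
      using dihedral_in_inj_seqs[OF k v] cycle_edges_dihedral[OF k v] by auto
  next
    fix w assume "w \<in> {w \<in> inj_seqs k A. cycle_edges k w = cycle_edges k v}"
    then have w: "w \<in> inj_seqs k A" and ew: "cycle_edges k w = cycle_edges k v" by auto
    have "{w 0, w 1} \<in> cycle_edges k w"
      unfolding cycle_edges_def using k by (intro image_eqI[of _ _ 0]) auto
    then obtain l where l: "l < k" "{w 0, w 1} = {v l, v (Suc l mod k)}"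
      unfolding ew by (auto simp: cycle_edges_def)
    obtain b j where bj: "j < k" "dihedral k v (b, j) 0 = w 0" "dihedral k v (b, j) 1 = w 1"
    proof (cases "w 0 = v l")
      case True
      then have "w 1 = v (Suc l mod k)" using l(2) by (auto simp: doubleton_eq_iff)
      then show ?thesis using that[of l True] True l at0 at1[of True l] by simp
    next
      case False
      then have "w 0 = v (Suc l mod k)" "w 1 = v l" using l(2) by (auto simp: doubleton_eq_iff)
      moreover have "(Suc l mod k + (k - 1)) mod k = l"
        using l(1) k by (cases "Suc l = k") auto
      ultimately show ?thesis using that[of "Suc l mod k" False] l at0[of "Suc l mod k" False] at1[of False "Suc l mod k"] k by simp
    qed
    have d: "dihedral k v (b, j) \<in> inj_seqs k A" by (rule dihedral_in_inj_seqs[OF k v])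
    have "w i = dihedral k v (b, j) i" if "i < k" for i
    proof (cases i)
      case 0 then show ?thesis using bj by simp
    next
      case (Suc i')
      then show ?thesis
        using cycle_edges_determined[OF k, of "dihedral k v (b, j)" w i'] d w that bj ew cycle_edges_dihedral[OF k v]
        by (auto simp: inj_seqs_def)
    qed
    moreover have "w \<in> extensional {..<k}" "dihedral k v (b, j) \<in> extensional {..<k}"
      using w d by (auto simp: inj_seqs_def PiE_def)
    ultimately have "w = dihedral k v (b, j)" by (intro extensionalityI[of _ "{..<k}"]) auto
    then show "w \<in> dihedral k v ` (UNIV \<times> {..<k})" using bj(1) by auto
  qed
qed

lemma card_inj_seqs:
  assumes "finite A" "k \<le> card A"
  shows "card (inj_seqs k A) = (card A choose k) * fact k"
proof -
  have "real (card (inj_seqs k A)) = real (prod ((-) (card A)) {0..<k})"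
    using card_inj_on_subset_funcset[of "{..<k}" A "{..<k}"] assms by (simp add: inj_seqs_def)
  also have "\<dots> = (\<Prod>i = 0..<k. real (card A) - real i)"
    unfolding of_nat_prod using assms by (intro prod.cong) auto
  also have "\<dots> = fact k * (real (card A) gchoose k)"
    by (simp add: gbinomial_mult_fact)
  also have "\<dots> = real ((card A choose k) * fact k)"
    by (simp add: binomial_gbinomial)
  finally show ?thesis by linarith
qed

lemma finite_inj_seqs: "finite A \<Longrightarrow> finite (inj_seqs k A)"
  unfolding inj_seqs_def by (rule finite_subset[OF _ finite_PiE[of "{..<k}" "\<lambda>_. A"]]) auto

text \<open>Every fibre of \<open>cycle_edges\<close> on \<open>inj_seqs k A\<close> has
  \<open>2 * k\<close> elements, namely the roots times the two orientations.\<close>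

lemma card_cycles:
  assumes k: "3 \<le> k" and A: "finite A" "k \<le> card A"
  shows "2 * k * card (cycle_edges k ` inj_seqs k A) = (card A choose k) * fact k"
proof -
  have fib: "card {w \<in> inj_seqs k A. cycle_edges k w = C} = 2 * k" if "C \<in> cycle_edges k ` inj_seqs k A" for C
  proof -
    from that obtain v where v: "v \<in> inj_seqs k A" "C = cycle_edges k v" by auto
    show ?thesis using bij_betw_same_card[OF bij_betw_dihedral[OF k v(1)]] v(2)
      by (simp add: card_cartesian_product)
  qed
  have "card (inj_seqs k A) = card (\<Union>C\<in>cycle_edges k ` inj_seqs k A. {w \<in> inj_seqs k A. cycle_edges k w = C})"
    by (rule arg_cong[of _ _ card]) auto
  also have "\<dots> = (\<Sum>C\<in>cycle_edges k ` inj_seqs k A. card {w \<in> inj_seqs k A. cycle_edges k w = C})"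
    using finite_inj_seqs[OF A(1), of k] by (intro card_UN_disjoint) auto
  also have "\<dots> = card (cycle_edges k ` inj_seqs k A) * (2 * k)"
    by (simp add: fib)
  finally show ?thesis using card_inj_seqs[OF A] by (simp add: mult_ac)
qed

section \<open>Cycles inside subgraphs of the complete graph\<close>

definition complete_edges :: "nat \<Rightarrow> nat set set" where
  "complete_edges n = {{i, j} | i j. (i, j) \<in> vertex_pairs n}"

lemma doubleton_in_complete_edges:
  "{a, b} \<in> complete_edges n \<longleftrightarrow> a \<noteq> b \<and> a \<in> {1..n} \<and> b \<in> {1..n}"
proof
  assume "a \<noteq> b \<and> a \<in> {1..n} \<and> b \<in> {1..n}"
  then have "(min a b, max a b) \<in> vertex_pairs n" "{a, b} = {min a b, max a b}"
    by (auto simp: vertex_pairs_def min_def max_def)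
  then show "{a, b} \<in> complete_edges n" unfolding complete_edges_def by blast
qed (auto simp: complete_edges_def vertex_pairs_def doubleton_eq_iff)

lemma cycle_edges_subset_complete:
  assumes k: "3 \<le> k" and v: "v \<in> inj_seqs k {1..n}"
  shows "cycle_edges k v \<subseteq> complete_edges n"
proof
  fix e assume "e \<in> cycle_edges k v"
  then obtain i where i: "i < k" "e = {v i, v (Suc i mod k)}" by (auto simp: cycle_edges_def)
  have "i \<noteq> Suc i mod k" using i k by (auto simp: mod_Suc)
  then have "v i \<noteq> v (Suc i mod k)"
    using v i inj_onD[of v "{..<k}" i "Suc i mod k"] by (auto simp: inj_seqs_def)
  moreover have "v i \<in> {1..n}" "v (Suc i mod k) \<in> {1..n}"
    using v i PiE_mem[of v "{..<k}" "\<lambda>_. {1..n}"] by (simp_all add: inj_seqs_def)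
  ultimately show "e \<in> complete_edges n"
    unfolding i(2) doubleton_in_complete_edges by simp
qed

text \<open>This replaces the cycles of a random graph by a fixed finite family, filtered by
  inclusion. The vertices of a cycle lie in \<open>{1..n}\<close> since each is an endpoint of an
  edge of the graph.\<close>

lemma cycles_in_subgraph:
  assumes k: "3 \<le> k" and E: "E \<subseteq> complete_edges n"
  shows "{C. C \<subseteq> E \<and> is_cycle k C} = {C \<in> cycle_edges k ` inj_seqs k {1..n}. C \<subseteq> E}"
proof (intro equalityI subsetI)
  fix C assume "C \<in> {C. C \<subseteq> E \<and> is_cycle k C}"
  then obtain v where C: "C \<subseteq> E" and v: "inj_on v {..<k}" "C = cycle_edges k v"
    unfolding is_cycle_def cycle_edges_def by (fastforce simp: image_def)
  define w where "w = restrict v {..<k}"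
  have "cycle_edges k w = C" using k v by (auto simp: w_def cycle_edges_def)
  moreover have "v i \<in> {1..n}" if "i < k" for i
  proof -
    have "{v i, v (Suc i mod k)} \<in> complete_edges n"
      using that C E v by (auto simp: cycle_edges_def)
    then show ?thesis by (simp add: doubleton_in_complete_edges)
  qed
  then have "w \<in> inj_seqs k {1..n}" using v(1) by (auto simp: w_def inj_seqs_def)
  ultimately show "C \<in> {C \<in> cycle_edges k ` inj_seqs k {1..n}. C \<subseteq> E}" using C by auto
qed (auto simp: is_cycle_def cycle_edges_def inj_seqs_def image_def)

lemma finite_vertex_pairs: "finite (vertex_pairs n)"
  by (rule finite_subset[of _ "{1..n} \<times> {1..n}"]) (auto simp: vertex_pairs_def)

text \<open>The event says that the coins of the cycle's edges, which are distinct, all show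
  \<open>True\<close>; independence gives the product.\<close>

lemma emeasure_cycle_subset:
  assumes k: "3 \<le> k" and v: "v \<in> inj_seqs k {1..n}"
    and p01: "\<And>i j. i \<in> {1..n} \<Longrightarrow> j \<in> {1..n} \<Longrightarrow> 0 \<le> p (h i) (h j) \<and> p (h i) (h j) \<le> 1"
    and sym: "\<And>x y. p x y = p y x"
  shows "emeasure (measure_pmf (graph_given_weights p n h)) {G. cycle_edges k v \<subseteq> G}
       = (\<Prod>i<k. ennreal (p (h (v i)) (h (v (Suc i mod k)))))"
proof -
  let ?C = "cycle_edges k v" and ?V = "vertex_pairs n"
  define EC where "EC = {(i, j) \<in> ?V. {i, j} \<in> ?C}"
  have sub: "?C \<subseteq> complete_edges n" by (rule cycle_edges_subset_complete[OF k v])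
  have vi: "v i \<in> {1..n}" if "i < k" for i using v that by (auto simp: inj_seqs_def PiE_def Pi_def)
  let ?q = "\<lambda>(i, j). bernoulli_pmf (p (h i) (h j))"
  let ?P = "Pi_pmf ?V False ?q"
  have "(?C \<subseteq> {{i, j} | i j. (i, j) \<in> ?V \<and> X (i, j)}) \<longleftrightarrow> X \<in> Pi ?V (\<lambda>e. if e \<in> EC then {True} else UNIV)" for X
  proof
    assume L: "?C \<subseteq> {{i, j} | i j. (i, j) \<in> ?V \<and> X (i, j)}"
    show "X \<in> Pi ?V (\<lambda>e. if e \<in> EC then {True} else UNIV)"
    proof
      fix e assume "e \<in> ?V"
      moreover obtain i j where e: "e = (i, j)" by (cases e)
      ultimately have ij: "(i, j) \<in> ?V" by simp
      show "X e \<in> (if e \<in> EC then {True} else UNIV)"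
      proof (cases "e \<in> EC")
        case True
        then have "{i, j} \<in> ?C" by (simp add: EC_def e)
        then obtain i' j' where "{i, j} = {i', j'}" "(i', j') \<in> ?V" "X (i', j')" using L by blast
        \<comment> \<open>Both pairs are increasing, so equality of the unordered edges forces
          equality of the pairs.\<close>
        then show ?thesis using ij True e by (auto simp: doubleton_eq_iff vertex_pairs_def)
      qed simp
    qed
  next
    assume R: "X \<in> Pi ?V (\<lambda>e. if e \<in> EC then {True} else UNIV)"
    show "?C \<subseteq> {{i, j} | i j. (i, j) \<in> ?V \<and> X (i, j)}"
    proof
      fix e assume e: "e \<in> ?C"
      then obtain i j where ij: "e = {i, j}" "(i, j) \<in> ?V" using sub by (auto simp: complete_edges_def)
      then have "(i, j) \<in> EC" using e by (simp add: EC_def)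
      then have "X (i, j)" using Pi_mem[OF R ij(2)] by simp
      then show "e \<in> {{i, j} | i j. (i, j) \<in> ?V \<and> X (i, j)}" using ij by blast
    qed
  qed
  then have "emeasure (measure_pmf (graph_given_weights p n h)) {G. ?C \<subseteq> G}
      = emeasure (measure_pmf ?P) (Pi ?V (\<lambda>e. if e \<in> EC then {True} else UNIV))"
    by (simp add: graph_given_weights_def vimage_def)
  also have "\<dots> = ennreal (\<Prod>e\<in>?V. measure_pmf.prob (?q e) (if e \<in> EC then {True} else UNIV))"
    by (simp add: measure_pmf.emeasure_eq_measure measure_Pi_pmf_Pi[OF finite_vertex_pairs])
  \<comment> \<open>As \<open>p\<close> takes values in the unit interval here,
    \<open>bernoulli_pmf\<close> does not clamp its parameter; unconstrained coins contribute
    1.\<close>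
  also have "(\<Prod>e\<in>?V. measure_pmf.prob (?q e) (if e \<in> EC then {True} else UNIV))
      = (\<Prod>e\<in>?V. if e \<in> EC then (case e of (i, j) \<Rightarrow> p (h i) (h j)) else 1)"
    using p01 by (intro prod.cong refl) (auto simp: measure_pmf_single vertex_pairs_def)
  also have "\<dots> = (\<Prod>e\<in>EC. case e of (i, j) \<Rightarrow> p (h i) (h j))"
    by (subst prod.inter_restrict[symmetric, OF finite_vertex_pairs]) (auto simp: EC_def intro!: prod.cong)
  also have "\<dots> = (\<Prod>i<k. p (h (v i)) (h (v (Suc i mod k))))"
  proof -
    \<comment> \<open>Coins are indexed by increasing pairs, so the endpoints of each cycle edge are
      sorted; symmetry of \<open>p\<close> makes the sorting harmless.\<close>
    define \<psi> where "\<psi> i = (min (v i) (v (Suc i mod k)), max (v i) (v (Suc i mod k)))" for i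
    have bij: "bij_betw \<psi> {..<k} EC"
      unfolding bij_betw_def
    proof
      have "{v i, v (Suc i mod k)} = {fst (\<psi> i), snd (\<psi> i)}" for i
        by (auto simp: \<psi>_def min_def max_def)
      then show "inj_on \<psi> {..<k}"
        using inj_on_cycle_edge[OF k, of v] v unfolding inj_on_def inj_seqs_def by simp
      show "\<psi> ` {..<k} = EC"
      proof (intro equalityI subsetI)
        fix e assume "e \<in> \<psi> ` {..<k}"
        then obtain i where i: "i < k" "e = \<psi> i" by auto
        let ?a = "v i" and ?b = "v (Suc i mod k)"
        have C: "{?a, ?b} \<in> ?C" using i by (auto simp: cycle_edges_def)
        then have "?a \<noteq> ?b" "?a \<in> {1..n}" "?b \<in> {1..n}"
          using subsetD[OF sub C] unfolding doubleton_in_complete_edges by simp_all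
        then have "(min ?a ?b, max ?a ?b) \<in> ?V"
          by (simp add: vertex_pairs_def min_def max_def)
        moreover have "{min ?a ?b, max ?a ?b} = {?a, ?b}"
          by (auto simp: min_def max_def)
        ultimately show "e \<in> EC" using C i(2) by (simp add: EC_def \<psi>_def)
      next
        fix e assume "e \<in> EC"
        then obtain i j l where "e = (i, j)" "i < j" "l < k" "{i, j} = {v l, v (Suc l mod k)}"
          by (auto simp: EC_def vertex_pairs_def cycle_edges_def)
        then show "e \<in> \<psi> ` {..<k}"
          by (intro image_eqI[of _ _ l]) (auto simp: \<psi>_def doubleton_eq_iff)
      qed
    qed
    have "(case \<psi> i of (i, j) \<Rightarrow> p (h i) (h j)) = p (h (v i)) (h (v (Suc i mod k)))" for i
      by (auto simp: \<psi>_def min_def max_def sym)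
    then show ?thesis using prod.reindex_bij_betw[OF bij, of "\<lambda>e. case e of (i, j) \<Rightarrow> p (h i) (h j)"]
      by simp
  qed
  also have "ennreal \<dots> = (\<Prod>i<k. ennreal (p (h (v i)) (h (v (Suc i mod k)))))"
    using p01 vi k by (intro prod_ennreal[symmetric]) auto
  finally show ?thesis .
qed

section \<open>The mean number of cycles as a trace\<close>

lemma measurable_weight_lawI:
  assumes "T \<in> N \<rightarrow>\<^sub>M borel" "\<And>u. 1 \<le> T u"
  shows "T \<in> N \<rightarrow>\<^sub>M weight_law \<tau>"
  unfolding weight_law_def measurable_density_eq2
  by (rule measurable_restrict_space2) (use assms in auto)

lemma measurable_edge_kernel:
  assumes "continuous_on {0..} f"
  shows "(\<lambda>(h, h'). ennreal (conn_prob \<tau> f n h h')) \<in> borel_measurable (weight_law \<sigma> \<Otimes>\<^sub>M weight_law \<sigma>)"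
proof -
  have [measurable]: "(\<lambda>h. h) \<in> borel_measurable (weight_law \<sigma>)"
    unfolding weight_law_def by (auto intro!: measurable_restrict_space1)
  have "(\<lambda>(h, h'). h * h' / (gam \<tau> n)\<^sup>2) \<in> (weight_law \<sigma> \<Otimes>\<^sub>M weight_law \<sigma>) \<rightarrow>\<^sub>M restrict_space borel {0..}"
    by (rule measurable_restrict_space2) (auto simp: space_pair_measure space_weight_law)
  from measurable_compose[OF this borel_measurable_continuous_on_restrict[OF assms]]
  show ?thesis by (simp add: conn_prob_def case_prod_beta')
qed

text \<open>Linearity of expectation: almost surely the graph is a subgraph of the complete graph,
  so its cycle count is a sum of indicators over a fixed family.\<close>

lemma nn_integral_num_cycles_given_weights:
  assumes k: "3 \<le> k"
    and p01: "\<And>i j. i \<in> {1..n} \<Longrightarrow> j \<in> {1..n} \<Longrightarrow> 0 \<le> p (h i) (h j) \<and> p (h i) (h j) \<le> 1"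
    and sym: "\<And>x y. p x y = p y x"
  shows "(\<integral>\<^sup>+G. ennreal (real (num_cycles k G)) \<partial>measure_pmf (graph_given_weights p n h))
    = (\<Sum>C\<in>cycle_edges k ` inj_seqs k {1..n}. emeasure (measure_pmf (graph_given_weights p n h)) {G. C \<subseteq> G})"
proof -
  let ?Cs = "cycle_edges k ` inj_seqs k {1..n}"
  have fin: "finite ?Cs" using finite_inj_seqs[of "{1..n}" k] by simp
  have "set_pmf (graph_given_weights p n h) \<subseteq> {G. G \<subseteq> complete_edges n}"
    by (auto simp: graph_given_weights_def complete_edges_def)
  then have "AE G in measure_pmf (graph_given_weights p n h). G \<subseteq> complete_edges n"
    by (auto simp: AE_measure_pmf_iff)
  then have "(\<integral>\<^sup>+G. ennreal (real (num_cycles k G)) \<partial>measure_pmf (graph_given_weights p n h))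
     = (\<integral>\<^sup>+G. (\<Sum>C\<in>?Cs. indicator {G. C \<subseteq> G} G) \<partial>measure_pmf (graph_given_weights p n h))"
  proof (intro nn_integral_cong_AE, eventually_elim)
    fix G assume "G \<subseteq> complete_edges n"
    then have "num_cycles k G = card {C \<in> ?Cs. C \<subseteq> G}"
      by (simp add: num_cycles_def cycles_in_subgraph[OF k])
    also have "ennreal (real \<dots>) = (\<Sum>C\<in>?Cs. indicator {G. C \<subseteq> G} G)"
    proof -
      have "real (card {C \<in> ?Cs. C \<subseteq> G}) = (\<Sum>C\<in>?Cs. if C \<subseteq> G then 1 else 0)"
        using fin by (simp add: sum.inter_filter[symmetric])
      also have "ennreal \<dots> = (\<Sum>C\<in>?Cs. ennreal (if C \<subseteq> G then 1 else 0))"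
        by (rule sum_ennreal[symmetric]) auto
      also have "\<dots> = (\<Sum>C\<in>?Cs. indicator {G. C \<subseteq> G} G)"
        by (intro sum.cong) auto
      finally show ?thesis .
    qed
    finally show "ennreal (real (num_cycles k G)) = (\<Sum>C\<in>?Cs. indicator {G. C \<subseteq> G} G)" .
  qed
  also have "\<dots> = (\<Sum>C\<in>?Cs. emeasure (measure_pmf (graph_given_weights p n h)) {G. C \<subseteq> G})"
    by (subst nn_integral_sum) auto
  finally show ?thesis .
qed

text \<open>After conditioning on the weights every cycle contributes the same amount, because the
  weights along any \<open>k\<close> distinct vertices are i.i.d. For \<open>n < k\<close> both
  sides vanish.\<close>

lemma avg_cycles_eq_trace:
  assumes tau: "1 < \<tau>" and cont: "continuous_on {0..} f"
    and f01: "\<And>x. 0 \<le> x \<Longrightarrow> 0 \<le> f x \<and> f x \<le> 1"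
    and k: "3 \<le> k"
  shows "avg_cycles \<tau> f k n = real (card (cycle_edges k ` inj_seqs k {1..n})) *
     enn2real (\<integral>\<^sup>+a. ker_pow (weight_law \<tau>) (\<lambda>h h'. ennreal (conn_prob \<tau> f n h h')) (k - 1) a a \<partial>weight_law \<tau>)"
proof -
  let ?W = "weight_law \<tau>" and ?p = "conn_prob \<tau> f n" and ?Cs = "cycle_edges k ` inj_seqs k {1..n}"
  let ?J = "\<lambda>h h'. ennreal (?p h h')"
  let ?I = "\<integral>\<^sup>+a. ker_pow ?W ?J (k - 1) a a \<partial>?W"
  interpret W: prob_space ?W by (rule prob_space_weight_law[OF tau])
  have sf: "sigma_finite_measure ?W" by (rule W.sigma_finite_measure_axioms)
  have K: "(\<lambda>h. measure_pmf (graph_given_weights ?p n h)) \<in> weights_law \<tau> n \<rightarrow>\<^sub>M subprob_algebra (count_space UNIV)"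
    by (rule measurable_graph_given_weights) (auto intro!: measurable_conn_prob cont simp: vertex_pairs_def)
  have "space (weights_law \<tau> n) \<noteq> {}"
    by (simp add: weights_law_def space_PiM space_weight_law PiE_eq_empty_iff)
  then have sets: "sets (inhom_random_graph \<tau> ?p n) = sets (count_space UNIV)"
    unfolding inhom_random_graph_def by (intro sets_bind) auto
  have h01: "0 \<le> ?p (h i) (h j) \<and> ?p (h i) (h j) \<le> 1"
    if "h \<in> space (weights_law \<tau> n)" "i \<in> {1..n}" "j \<in> {1..n}" for h i j
  proof -
    have "1 \<le> h i" "1 \<le> h j"
      using that by (auto simp: weights_law_def space_PiM space_weight_law PiE_def Pi_def)
    then show ?thesis unfolding conn_prob_def by (intro f01) simp
  qed
  have sym: "?p x y = ?p y x" for x y by (simp add: conn_prob_def mult.commute)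
  have "(\<integral>\<^sup>+G. ennreal (real (num_cycles k G)) \<partial>inhom_random_graph \<tau> ?p n)
      = (\<integral>\<^sup>+h. \<integral>\<^sup>+G. ennreal (real (num_cycles k G)) \<partial>measure_pmf (graph_given_weights ?p n h) \<partial>weights_law \<tau> n)"
    unfolding inhom_random_graph_def by (rule nn_integral_bind[OF _ K]) simp
  also have "\<dots> = (\<integral>\<^sup>+h. (\<Sum>C\<in>?Cs. emeasure (measure_pmf (graph_given_weights ?p n h)) {G. C \<subseteq> G}) \<partial>weights_law \<tau> n)"
    by (intro nn_integral_cong nn_integral_num_cycles_given_weights k h01 sym)
  also have "\<dots> = (\<Sum>C\<in>?Cs. \<integral>\<^sup>+h. emeasure (measure_pmf (graph_given_weights ?p n h)) {G. C \<subseteq> G} \<partial>weights_law \<tau> n)"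
    by (rule nn_integral_sum) (rule measurable_emeasure_kernel[OF K], simp)
  also have "\<dots> = (\<Sum>C\<in>?Cs. ?I)"
  proof (rule sum.cong[OF refl])
    fix C assume "C \<in> ?Cs"
    then obtain v where v: "v \<in> inj_seqs k {1..n}" and C: "C = cycle_edges k v" by auto
    let ?P = "PiM {..<k} (\<lambda>_. ?W)"
    have mP: "(\<lambda>x. \<Prod>i<k. ?J (x i) (x (Suc i mod k))) \<in> borel_measurable ?P"
    proof (rule borel_measurable_prod_ennreal)
      fix i assume i: "i \<in> {..<k}"
      have "(\<lambda>x. (x i, x (Suc i mod k))) \<in> ?P \<rightarrow>\<^sub>M ?W \<Otimes>\<^sub>M ?W"
        using i by (intro measurable_Pair measurable_component_singleton) auto
      from measurable_compose[OF this measurable_edge_kernel[OF cont]]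
      show "(\<lambda>x. ?J (x i) (x (Suc i mod k))) \<in> borel_measurable ?P" by simp
    qed
    have v': "v \<in> {..<k} \<rightarrow> {1..n}" "inj_on v {..<k}" using v by (auto simp: inj_seqs_def)
    \<comment> \<open>Reading the weights along the injective sequence \<open>v\<close> pushes the
      law of all \<open>n\<close> weights to the product law on \<open>{..<k}\<close>.\<close>
    have d: "distr (weights_law \<tau> n) ?P (\<lambda>h. \<lambda>i\<in>{..<k}. h (v i)) = ?P"
      using distr_PiM_reindex[of "{1..n}" "\<lambda>_. ?W" v "{..<k}"] v' W.prob_space_axioms
      by (simp add: weights_law_def)
    have mt: "(\<lambda>h. \<lambda>i\<in>{..<k}. h (v i)) \<in> weights_law \<tau> n \<rightarrow>\<^sub>M ?P"
      unfolding weights_law_def using v'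
      by (intro measurable_restrict measurable_component_singleton) auto
    have "(\<integral>\<^sup>+h. emeasure (measure_pmf (graph_given_weights ?p n h)) {G. C \<subseteq> G} \<partial>weights_law \<tau> n)
        = (\<integral>\<^sup>+h. (\<Prod>i<k. ?J (h (v i)) (h (v (Suc i mod k)))) \<partial>weights_law \<tau> n)"
      unfolding C by (intro nn_integral_cong emeasure_cycle_subset k v h01 sym)
    also have "\<dots> = (\<integral>\<^sup>+h. (\<Prod>i<k. ?J ((\<lambda>i\<in>{..<k}. h (v i)) i) ((\<lambda>i\<in>{..<k}. h (v i)) (Suc i mod k))) \<partial>weights_law \<tau> n)"
      using k by (intro nn_integral_cong prod.cong) auto
    also have "\<dots> = (\<integral>\<^sup>+x. (\<Prod>i<k. ?J (x i) (x (Suc i mod k))) \<partial>distr (weights_law \<tau> n) ?P (\<lambda>h. \<lambda>i\<in>{..<k}. h (v i)))"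
      by (rule nn_integral_distr[symmetric, OF mt]) (use mP in simp)
    also have "\<dots> = ?I"
    proof -
      obtain m where "k = Suc (Suc m)" using k that[of "k - 2"] by simp
      then show ?thesis
        unfolding d using nn_integral_PiM_cycle[OF sf measurable_edge_kernel[OF cont], of m] by simp
    qed
    finally show "(\<integral>\<^sup>+h. emeasure (measure_pmf (graph_given_weights ?p n h)) {G. C \<subseteq> G} \<partial>weights_law \<tau> n) = ?I" .
  qed
  also have "\<dots> = ennreal (real (card ?Cs)) * ?I"
    by (simp add: ennreal_of_nat_eq_real_of_nat)
  finally have "enn2real (\<integral>\<^sup>+G. ennreal (real (num_cycles k G)) \<partial>inhom_random_graph \<tau> ?p n) = real (card ?Cs) * enn2real ?I"
    by (simp add: enn2real_mult)
  moreover have "avg_cycles \<tau> f k n = enn2real (\<integral>\<^sup>+G. ennreal (real (num_cycles k G)) \<partial>inhom_random_graph \<tau> ?p n)"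
    unfolding avg_cycles_def
    by (rule integral_eq_nn_integral) (simp_all add: measurable_cong_sets[OF sets refl])
  ultimately show ?thesis by simp
qed

section \<open>Asymptotics\<close>

text \<open>The cut-off at \<open>- ln c\<close> is the image of the constraint that weights are at
  least 1.\<close>

definition truncated_kernel :: "real \<Rightarrow> (real \<Rightarrow> ennreal) \<Rightarrow> real \<Rightarrow> real \<Rightarrow> ennreal" where
  "truncated_kernel c F u v = indicator {- ln c..} u * indicator {- ln c..} v * F (u + v)"

lemma measurable_truncated_kernel:
  assumes [measurable]: "F \<in> borel_measurable borel"
  shows "case_prod (truncated_kernel c F) \<in> borel_measurable (lborel \<Otimes>\<^sub>M lborel)"
  unfolding truncated_kernel_def case_prod_beta' by measurable

lemma measurable_log_profile:
  fixes f :: "real \<Rightarrow> real"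
  assumes "continuous_on {0..} f"
  shows "(\<lambda>s. ennreal (exp ((1 - \<tau>) * s / 2) * f (exp s))) \<in> borel_measurable borel"
proof -
  have "continuous_on UNIV (\<lambda>s::real. exp ((1 - \<tau>) * s / 2) * f (exp s))"
    by (intro continuous_intros continuous_on_compose2[OF assms]) auto
  from measurable_compose[OF borel_measurable_continuous_onI[OF this] measurable_ennreal]
  show ?thesis .
qed

text \<open>The scale of the substitution is \<open>gam \<tau> n\<close>, so that the square in
  \<open>conn_prob\<close> cancels and the connection probability becomes
  \<open>f (exp (u + v))\<close>.\<close>

lemma trace_weight_law:
  assumes tau: "1 < \<tau>" and cont: "continuous_on {0..} f" and f_nonneg: "\<And>x. 0 \<le> x \<Longrightarrow> 0 \<le> f x"
    and c: "0 < gam \<tau> n"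
  defines "F \<equiv> \<lambda>s. ennreal (exp ((1 - \<tau>) * s / 2) * f (exp s))"
  shows "(\<integral>\<^sup>+a. ker_pow (weight_law \<tau>) (\<lambda>h h'. ennreal (conn_prob \<tau> f n h h')) m a a \<partial>weight_law \<tau>)
    = ennreal ((\<tau> - 1) * gam \<tau> n powr (1 - \<tau>)) ^ Suc m *
       (\<integral>\<^sup>+u. ker_pow lborel (truncated_kernel (gam \<tau> n) F) m u u \<partial>lborel)"
proof -
  let ?W = "weight_law \<tau>" and ?c = "gam \<tau> n"
  let ?J = "\<lambda>h h'. ennreal (conn_prob \<tau> f n h h')"
  define A where "A = ennreal ((\<tau> - 1) * ?c powr (1 - \<tau>))"
  define T where "T u = max 1 (?c * exp u)" for u
  define w :: "real \<Rightarrow> ennreal" where "w u = indicator {- ln ?c..} u * ennreal (exp ((1 - \<tau>) * u / 2))" for u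
  interpret W: prob_space ?W by (rule prob_space_weight_law[OF tau])
  have sf: "sigma_finite_measure ?W" by (rule W.sigma_finite_measure_axioms)
  note J = measurable_edge_kernel[OF cont, of \<tau> n \<tau>]
  have T: "T \<in> lborel \<rightarrow>\<^sub>M ?W"
    by (rule measurable_weight_lawI) (auto simp: T_def[abs_def])
  have w [measurable]: "w \<in> borel_measurable lborel" by (simp add: w_def[abs_def])
  have cov: "(\<integral>\<^sup>+h. \<phi> h \<partial>?W) = A * (\<integral>\<^sup>+u. \<phi> (T u) * (w u * w u) \<partial>lborel)"
    if "\<phi> \<in> borel_measurable ?W" for \<phi>
    unfolding A_def T_def w_def by (rule nn_integral_weight_law[OF that c tau])
  have kern: "(\<lambda>u v. w u * ?J (T u) (T v) * w v) = truncated_kernel ?c F"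
  proof (intro ext)
    fix u v :: real
    show "w u * ?J (T u) (T v) * w v = truncated_kernel ?c F u v"
    proof (cases "- ln ?c \<le> u \<and> - ln ?c \<le> v")
      case True
      have T': "T x = ?c * exp x" if "- ln ?c \<le> x" for x
      proof -
        have "exp (- ln ?c) \<le> exp x" using that by simp
        then have "1 \<le> ?c * exp x" using c by (simp add: exp_minus field_simps)
        then show ?thesis by (simp add: T_def)
      qed
      have "T u * T v / ?c\<^sup>2 = exp (u + v)"
        using True c by (simp add: T' exp_add power2_eq_square)
      then have "?J (T u) (T v) = ennreal (f (exp (u + v)))" by (simp add: conn_prob_def)
      moreover have "exp ((1 - \<tau>) * u / 2) * f (exp (u + v)) * exp ((1 - \<tau>) * v / 2)
         = exp ((1 - \<tau>) * (u + v) / 2) * f (exp (u + v))"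
        by (simp add: exp_add[symmetric] add_divide_distrib distrib_left)
      ultimately show ?thesis
        using True f_nonneg by (simp add: w_def truncated_kernel_def F_def ennreal_mult'[symmetric] ennreal_mult''[symmetric])
    next
      case False
      then show ?thesis by (auto simp: w_def truncated_kernel_def)
    qed
  qed
  have K: "w u * ker_pow ?W ?J m (T u) (T u) * w u = A ^ m * ker_pow lborel (truncated_kernel ?c F) m u u" for u
    unfolding kern[symmetric]
    by (rule ker_pow_change_of_variables[OF sf lborel.sigma_finite_measure_axioms J _ _ T w cov])
       (auto simp: T_def space_weight_law)
  have diag: "(\<lambda>a. ker_pow ?W ?J m a a) \<in> borel_measurable ?W"
    using measurable_compose[OF measurable_Pair[OF measurable_ident measurable_ident] measurable_ker_pow[OF sf J, of m]]
    by simp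
  have F [measurable]: "F \<in> borel_measurable borel"
    unfolding F_def by (rule measurable_log_profile[OF cont])
  have diag': "(\<lambda>u. ker_pow lborel (truncated_kernel ?c F) m u u) \<in> borel_measurable lborel"
    using measurable_compose[OF measurable_Pair[OF measurable_ident measurable_ident]
        measurable_ker_pow[OF lborel.sigma_finite_measure_axioms measurable_truncated_kernel[OF F]]]
    by simp
  \<comment> \<open>The outer integral of the trace supplies one more constant \<open>A\<close> and
    the two factors \<open>w\<close> at the ends, hence the exponent \<open>Suc m\<close>.\<close>
  have "(\<integral>\<^sup>+a. ker_pow ?W ?J m a a \<partial>?W) = A * (\<integral>\<^sup>+u. w u * ker_pow ?W ?J m (T u) (T u) * w u \<partial>lborel)"
    unfolding cov[OF diag] by (simp add: mult_ac)
  also have "\<dots> = A * (A ^ m * (\<integral>\<^sup>+u. ker_pow lborel (truncated_kernel ?c F) m u u \<partial>lborel))"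
    by (simp only: K nn_integral_cmult[OF diag'])
  finally show ?thesis by (simp add: A_def mult.assoc)
qed

text \<open>As \<open>c n\<close> grows the cut-off recedes to minus infinity, so the truncated
  kernels increase and at each point are eventually untruncated. Monotone convergence applies to the
  powers and once more to the trace.\<close>

lemma trace_truncated_LIMSEQ:
  fixes F :: "real \<Rightarrow> ennreal" and c :: "nat \<Rightarrow> real"
  assumes F [measurable]: "F \<in> borel_measurable borel" and fin: "\<And>s. F s < \<top>"
    and m: "even m"
    and c: "\<And>n. 0 < c n" "mono c" "filterlim c at_top sequentially"
  shows "(\<lambda>n. 2 * (\<integral>\<^sup>+u. ker_pow lborel (truncated_kernel (c n) F) m u u \<partial>lborel))
           \<longlonglongrightarrow> (\<integral>\<^sup>+s. F s \<partial>lborel) ^ Suc m"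
proof -
  have step: "truncated_kernel (c n) F a b \<le> truncated_kernel (c (Suc n)) F a b" for n a b
  proof -
    have "ln (c n) \<le> ln (c (Suc n))"
      using c(1) monoD[OF c(2), of n "Suc n"] by simp
    then show ?thesis
      by (auto simp: truncated_kernel_def indicator_def)
  qed
  have ev: "\<forall>\<^sub>F n in sequentially. truncated_kernel (c n) F a b = F (a + b)" for a b
  proof -
    have l: "filterlim (\<lambda>n. ln (c n)) at_top sequentially"
      by (rule filterlim_compose[OF ln_at_top c(3)])
    have "\<forall>\<^sub>F n in sequentially. - a \<le> ln (c n)" "\<forall>\<^sub>F n in sequentially. - b \<le> ln (c n)"
      using l by (auto simp: filterlim_at_top)
    then show ?thesis
      by eventually_elim (auto simp: truncated_kernel_def indicator_def)
  qed
  have lim: "(\<lambda>n. ker_pow lborel (truncated_kernel (c n) F) m a b) \<longlonglongrightarrow> ker_pow lborel (\<lambda>a b. F (a + b)) m a b" for a b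
    by (rule ker_pow_LIMSEQ[OF lborel.sigma_finite_measure_axioms measurable_truncated_kernel[OF F] step ev fin]) simp
  have "(\<lambda>n. \<integral>\<^sup>+u. ker_pow lborel (truncated_kernel (c n) F) m u u \<partial>lborel)
      \<longlonglongrightarrow> (\<integral>\<^sup>+u. ker_pow lborel (\<lambda>a b. F (a + b)) m u u \<partial>lborel)"
  proof (rule nn_integral_LIMSEQ)
    show "incseq (\<lambda>n u. ker_pow lborel (truncated_kernel (c n) F) m u u)"
      by (intro incseq_SucI le_funI ker_pow_mono step)
    show "(\<lambda>u. ker_pow lborel (truncated_kernel (c n) F) m u u) \<in> borel_measurable lborel" for n
      using measurable_compose[OF measurable_Pair[OF measurable_ident measurable_ident]
        measurable_ker_pow[OF lborel.sigma_finite_measure_axioms measurable_truncated_kernel[OF F]]]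
      by simp
  qed (rule lim)
  then show ?thesis
    unfolding trace_ker_pow_lborel[OF F m, symmetric] by (rule ennreal_tendsto_cmult[rotated]) simp
qed

section \<open>Finiteness, positivity and value of the profile integral\<close>

lemma nn_integral_exp_Ici:
  assumes "0 < a"
  shows "(\<integral>\<^sup>+u. ennreal (exp (- a * u)) * indicator {0..} u \<partial>lborel) = ennreal (1 / a)"
proof -
  have "((\<lambda>x. - (exp (- a * x) / a)) \<longlongrightarrow> - (0 / a)) at_top"
  proof (intro tendsto_intros filterlim_compose[OF exp_at_bot])
    show "filterlim (\<lambda>x. - a * x) at_bot at_top"
      using assms by (intro filterlim_tendsto_neg_mult_at_bot[OF tendsto_const _ filterlim_ident]) simp
  qed (use assms in simp)
  then show ?thesis
    using assms
    by (subst nn_integral_FTC_atLeast[where F = "\<lambda>x. - (exp (- a * x) / a)" and T = 0])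
       (auto intro!: derivative_eq_intros)
qed

context
  fixes \<tau> :: real and f :: "real \<Rightarrow> real"
  assumes tau: "1 < \<tau>" "\<tau> < 3"
    and f_cont: "continuous_on {0..} f"
    and f01: "\<And>x. 0 \<le> x \<Longrightarrow> 0 \<le> f x \<and> f x \<le> 1"
    and f_zero: "((\<lambda>x. f x / x) \<longlongrightarrow> 1) (at_right 0)"
    and f_top: "(f \<longlongrightarrow> 1) at_top"
begin

text \<open>Near 0 the quotient \<open>f x / x\<close> is below 2, a bound above its limit; beyond
  \<open>b\<close> the bound \<open>f x \<le> 1\<close> is at most \<open>x / b\<close>.\<close>

lemma linear_bound: "\<exists>C>0. \<forall>x>0. f x \<le> C * x"
proof -
  have "\<forall>\<^sub>F x in at_right 0. f x / x < 2"
    by (rule order_tendstoD[OF f_zero]) simp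
  then obtain b where b: "b > 0" "\<And>x. 0 < x \<Longrightarrow> x < b \<Longrightarrow> f x / x < 2"
    by (auto simp: eventually_at_right_field)
  have "f x \<le> max 2 (1 / b) * x" if x: "x > 0" for x
  proof (cases "x < b")
    case True
    then have "f x \<le> 2 * x" using b(2)[OF x] x by (simp add: field_simps)
    also have "\<dots> \<le> max 2 (1 / b) * x" using x by (intro mult_right_mono) auto
    finally show ?thesis .
  next
    case False
    have "f x \<le> 1" using f01[of x] x by simp
    also have "1 \<le> 1 / b * x" using False b(1) by (simp add: field_simps)
    also have "\<dots> \<le> max 2 (1 / b) * x" using x by (intro mult_right_mono) auto
    finally show ?thesis .
  qed
  then show ?thesis by (intro exI[of _ "max 2 (1 / b)"]) auto
qed

lemma nn_integral_log_profile_finite: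
  "(\<integral>\<^sup>+s. ennreal (exp ((1 - \<tau>) * s / 2) * f (exp s)) \<partial>lborel) < \<top>"
proof -
  obtain C where C: "C > 0" "\<And>x. x > 0 \<Longrightarrow> f x \<le> C * x" using linear_bound by blast
  \<comment> \<open>The exponential decay rates at minus infinity, from the linear bound on
    \<open>f\<close>, and at plus infinity, from \<open>f \<le> 1\<close>. They are positive since
    \<open>\<tau> < 3\<close> and \<open>1 < \<tau>\<close>.\<close>
  define a b where "a = (3 - \<tau>) / 2" and "b = (\<tau> - 1) / 2"
  have ab: "a > 0" "b > 0" using tau by (auto simp: a_def b_def)
  let ?E = "\<lambda>a u. ennreal (exp (- a * u)) * indicator {0..} u :: ennreal"
  have "(\<integral>\<^sup>+s. ennreal (exp ((1 - \<tau>) * s / 2) * f (exp s)) \<partial>lborel)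
      \<le> (\<integral>\<^sup>+s. ennreal C * ?E a (0 + (- 1) * s) + ?E b s \<partial>lborel)"
  proof (rule nn_integral_mono)
    fix s :: real
    show "ennreal (exp ((1 - \<tau>) * s / 2) * f (exp s)) \<le> ennreal C * ?E a (0 + (- 1) * s) + ?E b s"
    proof (cases "s \<ge> 0")
      case True
      have "exp ((1 - \<tau>) * s / 2) * f (exp s) \<le> exp (- b * s) * 1"
        using f01[of "exp s"] by (intro mult_mono) (auto simp: b_def field_simps)
      then have "ennreal (exp ((1 - \<tau>) * s / 2) * f (exp s)) \<le> ?E b s"
        using True by (simp add: ennreal_leI)
      then show ?thesis by (rule order_trans) simp
    next
      case False
      have "exp ((1 - \<tau>) * s / 2) * f (exp s) \<le> exp ((1 - \<tau>) * s / 2) * (C * exp s)"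
        by (intro mult_left_mono C) auto
      also have "\<dots> = C * exp (a * s)"
        by (simp add: exp_add[symmetric] a_def field_simps)
      finally have "ennreal (exp ((1 - \<tau>) * s / 2) * f (exp s)) \<le> ennreal C * ?E a (0 + (- 1) * s)"
        using False C(1) by (simp add: ennreal_leI ennreal_mult'[symmetric])
      then show ?thesis by (rule order_trans) simp
    qed
  qed
  also have "\<dots> = ennreal C * (\<integral>\<^sup>+s. ?E a (0 + (- 1) * s) \<partial>lborel) + (\<integral>\<^sup>+s. ?E b s \<partial>lborel)"
    by (subst nn_integral_add) (auto simp: nn_integral_cmult)
  also have "(\<integral>\<^sup>+s. ?E a (0 + (- 1) * s) \<partial>lborel) = (\<integral>\<^sup>+s. ?E a s \<partial>lborel)"
    by (subst nn_integral_real_affine[of "?E a" "- 1" 0]) simp_all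
  also have "ennreal C * (\<integral>\<^sup>+s. ?E a s \<partial>lborel) + (\<integral>\<^sup>+s. ?E b s \<partial>lborel) < \<top>"
    unfolding nn_integral_exp_Ici[OF ab(1)] nn_integral_exp_Ici[OF ab(2)]
    by (simp add: ennreal_mult_less_top)
  finally show ?thesis .
qed

lemma nn_integral_log_profile_pos:
  "0 < (\<integral>\<^sup>+s. ennreal (exp ((1 - \<tau>) * s / 2) * f (exp s)) \<partial>lborel)"
proof -
  have "\<forall>\<^sub>F x in at_top. 1 / 2 < f x"
    by (rule order_tendstoD[OF f_top]) simp
  then obtain M where M: "\<And>x. M \<le> x \<Longrightarrow> 1 / 2 < f x" by (auto simp: eventually_at_top_linorder)
  define L where "L = ln (max 1 M)"
  \<comment> \<open>The exponential is decreasing, so on \<open>{L..L + 1}\<close> it is smallest at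
    the right end; the factor one half bounds \<open>f\<close> from below there.\<close>
  define c where "c = exp ((1 - \<tau>) * (L + 1) / 2) * (1 / 2)"
  have "0 < ennreal c" by (simp add: c_def)
  also have "ennreal c = (\<integral>\<^sup>+s. ennreal c * indicator {L..L + 1} s \<partial>lborel)"
    by (simp add: nn_integral_cmult)
  also have "\<dots> \<le> (\<integral>\<^sup>+s. ennreal (exp ((1 - \<tau>) * s / 2) * f (exp s)) \<partial>lborel)"
  proof (rule nn_integral_mono)
    fix s :: real
    show "ennreal c * indicator {L..L + 1} s \<le> ennreal (exp ((1 - \<tau>) * s / 2) * f (exp s))"
    proof (cases "s \<in> {L..L + 1}")
      case True
      have "exp L \<le> exp s" using True by simp
      then have "M \<le> exp s" by (simp add: L_def)
      then have "1 / 2 \<le> f (exp s)" using M by (simp add: less_imp_le)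
      moreover have "(1 - \<tau>) * (L + 1) / 2 \<le> (1 - \<tau>) * s / 2"
        using True tau by (intro divide_right_mono mult_left_mono_neg) auto
      ultimately have "c \<le> exp ((1 - \<tau>) * s / 2) * f (exp s)"
        unfolding c_def by (intro mult_mono) auto
      then show ?thesis using True by (simp add: ennreal_leI)
    qed simp
  qed
  finally show ?thesis .
qed

text \<open>Under \<open>x = exp s\<close> the Jacobian raises the exponent
  \<open>- (\<tau> + 1) / 2\<close> by 1 to \<open>(1 - \<tau>) / 2\<close>. Finiteness is needed to
  read the Bochner integral back as an \<open>ennreal\<close>, since \<open>enn2real\<close> sends
  infinity to 0.\<close>

lemma nn_integral_log_profile:
  "(\<integral>\<^sup>+s. ennreal (exp ((1 - \<tau>) * s / 2) * f (exp s)) \<partial>lborel)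
     = ennreal (LBINT x:{0<..}. x powr (- (1/2) * (\<tau> + 1)) * f x)"
proof -
  let ?g = "\<lambda>x. indicator {0<..} x *\<^sub>R (x powr (- (1/2) * (\<tau> + 1)) * f x)"
  have "continuous_on {0<..} (\<lambda>x. x powr (- (1/2) * (\<tau> + 1)) * f x)"
    by (intro continuous_intros continuous_on_subset[OF f_cont]) auto
  then have m: "?g \<in> borel_measurable borel"
    by (intro borel_measurable_continuous_on_indicator) auto
  have "(\<integral>\<^sup>+x. ennreal (?g x) \<partial>lborel) = (\<integral>\<^sup>+x. ennreal (?g x) * indicator {0<..} x \<partial>lborel)"
    by (intro nn_integral_cong) (auto simp: indicator_def)
  also have "\<dots> = (\<integral>\<^sup>+u. ennreal (?g (exp u)) * ennreal (exp u) \<partial>lborel)"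
    by (rule nn_integral_exp_substitution) (use m in measurable)
  also have "\<dots> = (\<integral>\<^sup>+s. ennreal (exp ((1 - \<tau>) * s / 2) * f (exp s)) \<partial>lborel)"
  proof (rule nn_integral_cong)
    fix u :: real
    have "exp u powr (- (1/2) * (\<tau> + 1)) * exp u = exp ((1 - \<tau>) * u / 2)"
      by (simp add: powr_def exp_add[symmetric] field_simps)
    then have "?g (exp u) * exp u = exp ((1 - \<tau>) * u / 2) * f (exp u)"
      by (simp add: mult_ac)
    moreover have "0 \<le> ?g (exp u)" using f01[of "exp u"] by simp
    ultimately show "ennreal (?g (exp u)) * ennreal (exp u) = ennreal (exp ((1 - \<tau>) * u / 2) * f (exp u))"
      by (metis ennreal_mult')
  qed
  finally have eq: "(\<integral>\<^sup>+x. ennreal (?g x) \<partial>lborel) = (\<integral>\<^sup>+s. ennreal (exp ((1 - \<tau>) * s / 2) * f (exp s)) \<partial>lborel)" .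
  have "(LBINT x:{0<..}. x powr (- (1/2) * (\<tau> + 1)) * f x) = enn2real (\<integral>\<^sup>+x. ennreal (?g x) \<partial>lborel)"
    unfolding set_lebesgue_integral_def using m f01
    by (intro integral_eq_nn_integral) (auto simp: indicator_def)
  then show ?thesis
    unfolding eq using nn_integral_log_profile_finite by simp
qed

end

lemma filterlim_gam:
  assumes "0 < mu \<tau>"
  shows "filterlim (gam \<tau>) at_top sequentially"
  unfolding gam_def
  by (intro filterlim_compose[OF sqrt_at_top] filterlim_at_top_mult_tendsto_pos[OF tendsto_const assms]
      filterlim_real_sequentially)

theorem theorem3p7:
  fixes \<tau> :: real and f :: "real \<Rightarrow> real" and k :: nat
  assumes tau: "2 < \<tau>" "\<tau> < 3"
    and f_nonneg: "\<And>x. 0 \<le> x \<Longrightarrow> 0 \<le> f x"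
    and f_cont: "continuous_on {0..} f"
    and f_mono: "mono_on {0..} f"
    and f_zero: "((\<lambda>x. f x / x) \<longlongrightarrow> 1) (at_right 0)"
    and f_top: "(f \<longlongrightarrow> 1) at_top"
    and k: "odd k" "3 \<le> k"
  shows "(\<lambda>n. avg_cycles \<tau> f k n /
            (gam \<tau> n powr (real k * (1 - \<tau>)) * (\<tau> - 1) ^ k * (1 / (4 * real k))
              * real (n choose k) * fact k
              * (LBINT x:{0<..}. x powr (- (1/2) * (\<tau> + 1)) * f x) ^ k))
         \<longlonglongrightarrow> 1"
proof -
  define s where "s = (LBINT x:{0<..}. x powr (- (1/2) * (\<tau> + 1)) * f x)"
  define F where "F = (\<lambda>s. ennreal (exp ((1 - \<tau>) * s / 2) * f (exp s)))"
  define t where "t n = (\<integral>\<^sup>+u. ker_pow lborel (truncated_kernel (gam \<tau> n) F) (k - 1) u u \<partial>lborel)" for n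
  have tau': "1 < \<tau>" using tau by simp
  have f01: "0 \<le> f x \<and> f x \<le> 1" if "0 \<le> x" for x
  proof -
    \<comment> \<open>Monotonicity bounds \<open>f x\<close> by the limit 1 at infinity, so the
      connection probabilities are genuine.\<close>
    have "\<forall>\<^sub>F y in at_top. f x \<le> f y"
      using eventually_ge_at_top[of x] by eventually_elim (use that in \<open>auto intro: mono_onD[OF f_mono]\<close>)
    then show ?thesis using f_nonneg[OF that] tendsto_lowerbound[OF f_top] by simp
  qed
  note ctx = tau' tau(2) f_cont f01 f_zero f_top
  have F: "F \<in> borel_measurable borel"
    unfolding F_def using measurable_log_profile[OF f_cont] by simp
  have intF: "(\<integral>\<^sup>+u. F u \<partial>lborel) = ennreal s"
    unfolding F_def s_def using nn_integral_log_profile[OF ctx] by simp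
  have s: "0 < s"
    using nn_integral_log_profile_pos[OF ctx] intF unfolding F_def by simp
  have mu: "0 < mu \<tau>" using tau by (simp add: mu_def)
  have gam: "0 < gam \<tau> n" if "0 < n" for n
    using that mu by (simp add: gam_def)
  \<comment> \<open>The index is shifted because \<open>gam \<tau> 0 = 0\<close>, while the limit
    lemma asks for positive scales. Since \<open>k\<close> is odd, the exponent parameter
    \<open>k - 1\<close> is even.\<close>
  have "(\<lambda>n. 2 * t (Suc n)) \<longlonglongrightarrow> (\<integral>\<^sup>+u. F u \<partial>lborel) ^ Suc (k - 1)"
    unfolding t_def
  proof (rule trace_truncated_LIMSEQ[OF F])
    show "mono (\<lambda>n. gam \<tau> (Suc n))"
      using mu by (auto intro!: monoI mult_right_mono simp: gam_def)
    show "filterlim (\<lambda>n. gam \<tau> (Suc n)) at_top sequentially"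
      by (rule filterlim_compose[OF filterlim_gam[OF mu] filterlim_Suc])
  qed (use k gam in \<open>auto simp: F_def\<close>)
  then have "(\<lambda>n. 2 * t n) \<longlonglongrightarrow> ennreal (s ^ k)"
    using k s by (subst (asm) filterlim_sequentially_Suc) (simp add: intF ennreal_power)
  then have "(\<lambda>n. enn2real (2 * t n)) \<longlonglongrightarrow> enn2real (ennreal (s ^ k))"
    by (intro tendsto_enn2real) auto
  then have "(\<lambda>n. 2 * enn2real (t n) / s ^ k) \<longlonglongrightarrow> s ^ k / s ^ k"
    using s by (intro tendsto_divide tendsto_const) (simp_all add: enn2real_mult)
  then have lim: "(\<lambda>n. 2 * enn2real (t n) / s ^ k) \<longlonglongrightarrow> 1"
    using s by simp
  have "\<forall>\<^sub>F n in sequentially. 2 * enn2real (t n) / s ^ k = avg_cycles \<tau> f k n /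
      (gam \<tau> n powr (real k * (1 - \<tau>)) * (\<tau> - 1) ^ k * (1 / (4 * real k)) * real (n choose k) * fact k * s ^ k)"
    \<comment> \<open>For \<open>n \<ge> k\<close> the binomial coefficient is positive and the
      quotient is meaningful.\<close>
    using eventually_ge_at_top[of k]
  proof eventually_elim
    case (elim n)
    define N where "N = real (card (cycle_edges k ` inj_seqs k {1..n}))"
    define P where "P = gam \<tau> n powr (real k * (1 - \<tau>)) * (\<tau> - 1) ^ k"
    have n: "0 < gam \<tau> n" using elim k gam by simp
    \<comment> \<open>Together with the prefactor \<open>1 / (4 * real k)\<close> this leaves
      \<open>N / 2\<close>, whose one half matches the factor 2 in front of the trace.\<close>
    have cf: "real (n choose k) * fact k = 2 * real k * N"
      using arg_cong[OF card_cycles[OF k(2), of "{1..n}"], of real] elim by (simp add: N_def mult_ac)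
    have "0 < real (n choose k) * fact k" using elim by simp
    then have N: "0 < N" using cf k by (simp add: zero_less_mult_iff)
    have P: "0 < P" using n tau by (simp add: P_def)
    have "((\<tau> - 1) * gam \<tau> n powr (1 - \<tau>)) ^ k = P"
      using n by (simp add: P_def power_mult_distrib powr_power mult.commute)
    moreover have "avg_cycles \<tau> f k n = N * enn2real (ennreal ((\<tau> - 1) * gam \<tau> n powr (1 - \<tau>)) ^ Suc (k - 1) * t n)"
    proof -
      have "avg_cycles \<tau> f k n = N * enn2real (\<integral>\<^sup>+a. ker_pow (weight_law \<tau>)
          (\<lambda>h h'. ennreal (conn_prob \<tau> f n h h')) (k - 1) a a \<partial>weight_law \<tau>)"
        unfolding N_def by (rule avg_cycles_eq_trace[OF tau' f_cont f01 k(2)])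
      then show ?thesis
        by (subst (asm) trace_weight_law[OF tau' f_cont f_nonneg n]) (auto simp: t_def F_def)
    qed
    ultimately have "avg_cycles \<tau> f k n = N * (P * enn2real (t n))"
      using k tau P by (simp add: enn2real_mult ennreal_power)
    then have "avg_cycles \<tau> f k n / (P * (1 / (4 * real k)) * (2 * real k * N) * s ^ k) = 2 * enn2real (t n) / s ^ k"
      using N P s k by (simp add: field_simps)
    then show ?case unfolding cf[symmetric] P_def by (simp add: mult.assoc)
  qed
  from Lim_transform_eventually[OF lim this] show ?thesis unfolding s_def .
qed

end
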